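(* Let $\mathbb{B}^n$ be the unit ball in $\mathbb{C}^n$ and $\mathbb{S}^n=\partial\mathbb{B}^n$ the unit sphere. For each real $\alpha<1$ there is a number $t_\alpha>1$ such that for each $\varepsilon>0$ there exists a function $f\in A^2_\alpha(\mathbb{B}^n)$ so that for each $\zeta\in\mathbb{S}^n$, $$\limsup\, |f(z)|\,(1-|z|)^{\frac{1-\alpha}{2}}\left|\log(1-|z|)\right|^{\frac{1+\varepsilon}{2}}>0$$ as $z\to\zeta$ from the inside of the Koranyi region $$\mathcal{A}_{t_\alpha}(\zeta)=\left\{z\in\mathbb{B}^n:\ |1-z\cdot\bar\zeta|<t_\alpha(1-|z|)\right\}.$$
   Context: For $a,b\in\mathbb{C}^n$, $a\cdot\bar b=\sum_j a_j\bar b_j$. $A^2_\alpha(\mathbb{B}^n)$ is the space of holomorphic functions $f$ on $\mathbb{B}^n$ with $\int_{\mathbb{B}^n}|f|^2\delta^{-\alpha}\,dV<\infty$, where $\delta(z)=1-|z|$ is the distance to the boundary and $dV$ is Lebesgue measure. *)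

theory Defs
  imports "HOL-Analysis.Analysis"
begin

definition hermitian_dot :: "complex ^ 'n::finite \<Rightarrow> complex ^ 'n \<Rightarrow> complex" where
  "hermitian_dot a b = (\<Sum>j\<in>UNIV. a $ j * cnj (b $ j))"

(* Holomorphy in several variables on an open set: real Frechet differentiability
   with complex-linear derivative. *)
definition holomorphic_several_on ::
    "(complex ^ 'n::finite \<Rightarrow> complex) \<Rightarrow> (complex ^ 'n) set \<Rightarrow> bool" where
  "holomorphic_several_on f S \<longleftrightarrow>
     (\<forall>z\<in>S. \<exists>D. (f has_derivative D) (at z) \<and> (\<forall>c v. D (c *s v) = c * D v))"

(* Members are total functions whose values outside the ball are irrelevant. *)
definition weighted_bergman_space ::
    "real \<Rightarrow> (complex ^ 'n::finite \<Rightarrow> complex) set" where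
  "weighted_bergman_space \<alpha> =
     {f. holomorphic_several_on f (ball 0 1) \<and>
         (\<integral>\<^sup>+ z \<in> ball 0 1.
            ennreal ((cmod (f z))\<^sup>2 * (1 - norm z) powr (- \<alpha>)) \<partial>lborel) < \<infinity>}"

definition koranyi_region :: "real \<Rightarrow> complex ^ 'n::finite \<Rightarrow> (complex ^ 'n) set" where
  "koranyi_region t \<zeta> =
     {z \<in> ball 0 1. cmod (1 - hermitian_dot z \<zeta>) < t * (1 - norm z)}"

end

theory Submission
  imports
    Defs
    "HOL-Complex_Analysis.Cauchy_Integral_Formula"
    "HOL-Real_Asymp.Real_Asymp"
begin

text \<open>
  On the unit sphere a monomial \<open>z\<^sup>a\<close> of degree \<open>N\<close>, normalised to have maximum modulus \<open>1\<close>, is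
  dominated by a Gaussian of width \<open>N\<^sup>-\<^sup>1\<^sup>/\<^sup>2\<close> in the vector of moduli \<open>\<bar>z\<^sub>j\<bar>\<close>, centred at
  \<open>(sqrt (a\<^sub>j / N))\<^sub>j\<close>. Choosing a coordinate \<open>i\<close> and \<open>a\<^sub>j = (L k\<^sub>j)\<^sup>2\<close> for \<open>j \<noteq> i\<close> puts these centres on a
  lattice of spacing \<open>L N\<^sup>-\<^sup>1\<^sup>/\<^sup>2\<close>; for \<open>L\<close> large the sum of all these monomials is bounded on the sphere,
  yet at least \<open>1 / 2\<close> in modulus at every centre. Every point whose largest coordinate is the
  \<open>i\<close>-th lies at distance \<open>O(N\<^sup>-\<^sup>1\<^sup>/\<^sup>2)\<close> from a point over a centre, hence its Koranyi region of a fixed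
  large aperture contains a point with \<open>1 - \<bar>z\<bar> = 1 / N\<close> where the polynomial is large. The function
  is the series of these polynomials of degrees \<open>N\<close> growing doubly exponentially, with coefficients
  \<open>(ln N)\<close> to the power \<open>- (1 + \<epsilon>) / 2\<close> times \<open>N\<close> to the power \<open>(1 - \<alpha>) / 2\<close>, the coordinate \<open>i\<close>
  running cyclically through all indices.
\<close>

section \<open>Holomorphic functions of several variables\<close>

lemma norm_smult_vec: "norm (x *s v) = cmod x * norm v" for v :: "complex ^ 'n::finite"
  by (simp add: norm_vec_def L2_set_def norm_mult power_mult_distrib real_sqrt_mult
      flip: sum_distrib_left)

lemma holomorphic_several_on_const: "holomorphic_several_on (\<lambda>z. c) S"
  unfolding holomorphic_several_on_def
  by (auto intro!: exI[of _ "\<lambda>_. 0"])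

lemma holomorphic_several_on_coord: "holomorphic_several_on (\<lambda>z. z $ j) S"
  unfolding holomorphic_several_on_def
  by (auto intro!: exI[of _ "\<lambda>v. v $ j"] bounded_linear_imp_has_derivative)

lemma holomorphic_several_on_add:
  assumes "holomorphic_several_on f S" "holomorphic_several_on g S"
  shows "holomorphic_several_on (\<lambda>z. f z + g z) S"
  unfolding holomorphic_several_on_def
proof
  fix z assume z: "z \<in> S"
  obtain D E where "(f has_derivative D) (at z)" "\<forall>c v. D (c *s v) = c * D v"
    "(g has_derivative E) (at z)" "\<forall>c v. E (c *s v) = c * E v"
    using assms z unfolding holomorphic_several_on_def by blast
  then show "\<exists>D. ((\<lambda>z. f z + g z) has_derivative D) (at z) \<and> (\<forall>c v. D (c *s v) = c * D v)"
    by (intro exI[of _ "\<lambda>v. D v + E v"] conjI has_derivative_add) (auto simp: distrib_left)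
qed

lemma holomorphic_several_on_mult:
  assumes "holomorphic_several_on f S" "holomorphic_several_on g S"
  shows "holomorphic_several_on (\<lambda>z. f z * g z) S"
  unfolding holomorphic_several_on_def
proof
  fix z assume z: "z \<in> S"
  obtain D E where "(f has_derivative D) (at z)" "\<forall>c v. D (c *s v) = c * D v"
    "(g has_derivative E) (at z)" "\<forall>c v. E (c *s v) = c * E v"
    using assms z unfolding holomorphic_several_on_def by blast
  then show "\<exists>D. ((\<lambda>z. f z * g z) has_derivative D) (at z) \<and> (\<forall>c v. D (c *s v) = c * D v)"
    by (intro exI[of _ "\<lambda>v. f z * E v + D v * g z"] conjI has_derivative_mult)
      (auto simp: algebra_simps)
qed

lemma holomorphic_several_on_sum:
  assumes "\<And>i. i \<in> I \<Longrightarrow> holomorphic_several_on (f i) S"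
  shows "holomorphic_several_on (\<lambda>z. \<Sum>i\<in>I. f i z) S"
  using assms
  by (induction I rule: infinite_finite_induct)
    (auto intro: holomorphic_several_on_const holomorphic_several_on_add)

lemma holomorphic_several_on_prod:
  assumes "\<And>i. i \<in> I \<Longrightarrow> holomorphic_several_on (f i) S"
  shows "holomorphic_several_on (\<lambda>z. \<Prod>i\<in>I. f i z) S"
  using assms
  by (induction I rule: infinite_finite_induct)
    (auto intro: holomorphic_several_on_const holomorphic_several_on_mult)

lemma holomorphic_several_on_power:
  assumes "holomorphic_several_on f S"
  shows "holomorphic_several_on (\<lambda>z. f z ^ n) S"
  using assms
  by (induction n) (auto intro: holomorphic_several_on_const holomorphic_several_on_mult)

lemma holomorphic_several_on_subset:
  "holomorphic_several_on f S \<Longrightarrow> T \<subseteq> S \<Longrightarrow> holomorphic_several_on f T"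
  by (auto simp: holomorphic_several_on_def)

text \<open>Cauchy's estimate on the complex line through \<open>z\<close> in direction \<open>v\<close>.\<close>
lemma holomorphic_several_derivative_bound:
  fixes f :: "complex ^ 'n::finite \<Rightarrow> complex"
  assumes hol: "holomorphic_several_on f (cball z \<rho>)" and "0 < \<rho>"
    and bd: "\<And>w. w \<in> cball z \<rho> \<Longrightarrow> cmod (f w) \<le> B"
    and D: "(f has_derivative D) (at z)" and Dlin: "\<And>c v. D (c *s v) = c * D v"
  shows "cmod (D v) \<le> B / \<rho> * norm v"
proof (cases "v = 0")
  case True
  then show ?thesis using Dlin[of 0 0] by simp
next
  case False
  \<comment> \<open>In the parameter of the complex line the ball of radius \<open>\<rho>\<close>
    becomes the disc of radius \<open>r\<close>, so the one-variable Cauchy inequality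
    \<open>B / r\<close> is the desired bound.\<close>
  define r where "r = \<rho> / norm v"
  have r: "0 < r" using assms False by (simp add: r_def)
  define \<phi> where "\<phi> = (\<lambda>x. f (z + x *s v))"
  have line: "((\<lambda>x. z + x *s v) has_derivative (\<lambda>h. h *s v)) (at x)" for x :: complex
  proof -
    have "bounded_linear (\<lambda>h. h *s v)"
      by (rule bounded_linear_intro[where K = "norm v"])
        (auto simp: vec_eq_iff algebra_simps norm_smult_vec)
    then have "((\<lambda>x. x *s v) has_derivative (\<lambda>h. h *s v)) (at x)"
      by (rule bounded_linear_imp_has_derivative)
    then show ?thesis by (auto intro!: derivative_eq_intros)
  qed
  have der: "(\<phi> has_field_derivative E v) (at x)"
    if "(f has_derivative E) (at (z + x *s v))" "\<And>c v. E (c *s v) = c * E v" for x E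
  proof -
    have "(\<phi> has_derivative (\<lambda>h. E (h *s v))) (at x)"
      unfolding \<phi>_def using has_derivative_compose[OF line that(1)] by simp
    then show ?thesis
      unfolding has_field_derivative_def that(2) by (simp add: mult_commute_abs)
  qed
  have inb: "z + x *s v \<in> cball z \<rho>" if "cmod x \<le> r" for x
    using that False by (simp add: dist_norm norm_smult_vec r_def pos_le_divide_eq)
  have diff: "\<exists>d. (\<phi> has_field_derivative d) (at x)" if "cmod x \<le> r" for x
    using hol inb[OF that] der unfolding holomorphic_several_on_def by blast
  have "norm ((deriv ^^ 1) \<phi> 0) \<le> fact 1 * B / r ^ 1"
  proof (rule Cauchy_inequality)
    show "\<phi> holomorphic_on ball 0 r"
      unfolding holomorphic_on_def field_differentiable_def
    proof
      fix x assume "x \<in> ball (0::complex) r"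
      then have "cmod x \<le> r" by simp
      from diff[OF this] show "\<exists>d. (\<phi> has_field_derivative d) (at x within ball 0 r)"
        using has_field_derivative_at_within by blast
    qed
    show "continuous_on (cball 0 r) \<phi>"
    proof (rule continuous_at_imp_continuous_on, rule ballI)
      fix x assume "x \<in> cball (0::complex) r"
      then have "cmod x \<le> r" by simp
      from diff[OF this] show "isCont \<phi> x" using DERIV_isCont by blast
    qed
    show "cmod (\<phi> x) \<le> B" if "cmod (0 - x) = r" for x
      unfolding \<phi>_def using that by (intro bd inb) simp
  qed (fact r)
  moreover have "deriv \<phi> 0 = D v"
    using der[of D 0] D Dlin by (intro DERIV_imp_deriv) simp
  ultimately show ?thesis by (simp add: r_def)
qed

text \<open>A Weierstrass theorem. On a smaller ball Cauchy's estimate turns summable bounds for the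
  functions into summable bounds for their derivatives, so termwise differentiation applies, and
  complex linearity passes to the sum of the derivatives.\<close>

lemma holomorphic_several_on_suminf:
  fixes f :: "nat \<Rightarrow> complex ^ 'n::finite \<Rightarrow> complex"
  assumes hol: "\<And>n. holomorphic_several_on (f n) (ball 0 R)"
    and bd: "\<And>r. 0 < r \<Longrightarrow> r < R \<Longrightarrow> \<exists>M. summable M \<and> (\<forall>n. \<forall>z\<in>cball 0 r. cmod (f n z) \<le> M n)"
  shows "holomorphic_several_on (\<lambda>z. \<Sum>n. f n z) (ball 0 R)"
  unfolding holomorphic_several_on_def
proof
  fix z0 :: "complex ^ 'n" assume "z0 \<in> ball 0 R"
  then have z0: "norm z0 < R" by simp
  \<comment> \<open>A third of the gap to the boundary: closed balls of radius \<open>\<rho>\<close>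
    about points of \<open>S\<close> stay inside \<open>cball 0 r\<close>, and
    \<open>r = R - \<rho>\<close> is still below \<open>R\<close>.\<close>
  define \<rho> where "\<rho> = (R - norm z0) / 3"
  define r where "r = norm z0 + 2 * \<rho>"
  have \<rho>: "0 < \<rho>" using z0 by (simp add: \<rho>_def)
  have r: "0 < r" "r < R" using \<rho> z0 norm_ge_zero[of z0] unfolding r_def by (linarith, simp add: \<rho>_def field_simps)
  obtain M where M: "summable M" "\<And>n z. norm z \<le> r \<Longrightarrow> cmod (f n z) \<le> M n"
    using bd[OF r] by auto
  define S where "S = ball z0 \<rho>"
  have sub: "cball z \<rho> \<subseteq> cball 0 r" if "z \<in> S" for z
  proof
    fix w assume "w \<in> cball z \<rho>"
    then have "norm (w - z) \<le> \<rho>" by (simp add: dist_norm norm_minus_commute)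
    moreover have "norm (z - z0) < \<rho>" using that by (simp add: S_def dist_norm norm_minus_commute)
    ultimately show "w \<in> cball 0 r"
      using norm_triangle_ineq[of "w - z" z] norm_triangle_ineq[of "z - z0" z0] by (simp add: r_def)
  qed
  have subR: "cball 0 r \<subseteq> ball (0 :: complex ^ 'n) R" using r by auto
  have "\<exists>D. \<forall>n. \<forall>z\<in>ball 0 R. (f n has_derivative D n z) (at z) \<and> (\<forall>c v. D n z (c *s v) = c * D n z v)"
    using hol unfolding holomorphic_several_on_def by metis
  then obtain D where D: "\<And>n z. z \<in> ball 0 R \<Longrightarrow> (f n has_derivative D n z) (at z)"
    and Dlin: "\<And>n z c v. z \<in> ball 0 R \<Longrightarrow> D n z (c *s v) = c * D n z v"
    by blast
  have SR: "z \<in> ball 0 R" if "z \<in> S" for z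
    using sub[OF that] subR \<rho> by (meson centre_in_cball less_imp_le subsetD)
  have Dbd: "cmod (D n z v) \<le> M n / \<rho> * norm v" if "z \<in> S" for n z v
  proof (rule holomorphic_several_derivative_bound[of "f n"])
    show "holomorphic_several_on (f n) (cball z \<rho>)"
      using sub[OF that] subR by (intro holomorphic_several_on_subset[OF hol]) auto
    show "cmod (f n w) \<le> M n" if "w \<in> cball z \<rho>" for w
      using M(2) sub[OF \<open>z \<in> S\<close>] that by auto
  qed (use D Dlin SR that \<rho> in auto)
  have Msum: "summable (\<lambda>n. M n / \<rho> * c)" for c
    using M(1) by (intro summable_mult2 summable_divide)
  have Dsum: "summable (\<lambda>n. D n z v)" if "z \<in> S" for z v
    using Dbd[OF that] by (intro summable_comparison_test'[OF Msum[of "norm v"]]) auto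
  define g' where "g' = (\<lambda>z v. \<Sum>n. D n z v)"
  have z0S: "z0 \<in> S" using \<rho> by (simp add: S_def)
  have fsum: "summable (\<lambda>n. f n z)" if "z \<in> S" for z
  proof -
    have "norm z \<le> r" using sub[OF that] \<rho> by (auto simp: subset_iff)
    then show ?thesis using M by (intro summable_comparison_test'[OF M(1)]) auto
  qed
  have unif: "\<forall>\<^sub>F n in sequentially. \<forall>z\<in>S. \<forall>h. norm ((\<Sum>i<n. D i z h) - g' z h) \<le> e * norm h"
    if "0 < e" for e
  proof -
    define T where "T = (\<lambda>n. \<Sum>i. M (i + n) / \<rho>)"
    have sM: "summable (\<lambda>n. M n / \<rho>)" using M(1) by (rule summable_divide)
    have "T \<longlonglongrightarrow> 0" unfolding T_def using sM by (rule suminf_exist_split2)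
    then have "\<forall>\<^sub>F n in sequentially. T n < e" using that by (rule order_tendstoD)
    then show ?thesis
    proof eventually_elim
      case (elim n)
      show ?case
      proof (intro ballI allI)
        fix z h :: "complex ^ 'n" assume z: "z \<in> S"
        have sn: "summable (\<lambda>i. M (i + n) / \<rho> * norm h)"
          using Msum[of "norm h"] by (rule summable_ignore_initial_segment)
        have "norm ((\<Sum>i<n. D i z h) - g' z h) = norm (\<Sum>i. D (i + n) z h)"
          unfolding g'_def using suminf_minus_initial_segment[OF Dsum[OF z, of h], of n]
          by (simp add: norm_minus_commute)
        also have "\<dots> \<le> (\<Sum>i. M (i + n) / \<rho> * norm h)"
          using Dbd[OF z] by (intro norm_suminf_le sn) auto
        also have "\<dots> = T n * norm h"
          unfolding T_def using summable_ignore_initial_segment[OF sM]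
          by (subst suminf_mult2) auto
        also have "\<dots> \<le> e * norm h" using elim by (intro mult_right_mono) auto
        finally show "norm ((\<Sum>i<n. D i z h) - g' z h) \<le> e * norm h" .
      qed
    qed
  qed
  have "\<exists>g. \<forall>z\<in>S. (\<lambda>n. f n z) sums (g z) \<and> (g has_derivative g' z) (at z within S)"
  proof (rule has_derivative_series)
    show "convex S" by (simp add: S_def)
    show "(f n has_derivative D n z) (at z within S)" if "z \<in> S" for n z
      using D[OF SR[OF that]] by (rule has_derivative_at_withinI)
    show "(\<lambda>n. f n z0) sums (\<Sum>n. f n z0)" using fsum[OF z0S] by (rule summable_sums)
  qed (use unif z0S in auto)
  then obtain g where g: "\<And>z. z \<in> S \<Longrightarrow> (\<lambda>n. f n z) sums (g z)"
    "\<And>z. z \<in> S \<Longrightarrow> (g has_derivative g' z) (at z within S)" by blast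
  have "(g has_derivative g' z0) (at z0)"
    using g(2)[OF z0S] z0S by (simp add: S_def at_within_open[of _ "ball z0 \<rho>"])
  then have "((\<lambda>z. \<Sum>n. f n z) has_derivative g' z0) (at z0)"
    by (rule has_derivative_transform_within_open[where s = S])
      (use g(1) z0S in \<open>auto simp: S_def sums_iff\<close>)
  moreover have "g' z0 (c *s v) = c * g' z0 v" for c v
    unfolding g'_def using Dlin[OF SR[OF z0S]] suminf_mult[OF Dsum[OF z0S]] by simp
  ultimately show "\<exists>D. ((\<lambda>z. \<Sum>n. f n z) has_derivative D) (at z0) \<and>
      (\<forall>c v. D (c *s v) = c * D v)" by blast
qed

section \<open>Peak polynomials\<close>

text \<open>Splitting \<open>K\<close> at \<open>m\<close> leaves at most one term equal to 1 and
  two pieces that reindex to parts of the geometric series starting at \<open>q\<close>. The bound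
  depends neither on \<open>m\<close> nor on \<open>K\<close>. It serves both the Gaussian lattice
  sums and the sum over dyadic shells.\<close>

lemma sum_geometric_dist_le:
  fixes q :: real and K :: "nat set"
  assumes "0 \<le> q" "q < 1" "finite K"
  shows "(\<Sum>k\<in>K. q ^ nat \<bar>int k - int m\<bar>) \<le> 1 + 2 * (q / (1 - q))"
proof -
  let ?g = "\<lambda>k. q ^ nat \<bar>int k - int m\<bar>"
  have geo: "(\<Sum>i\<in>I. q ^ Suc i) \<le> q / (1 - q)" if "finite I" for I :: "nat set"
  proof -
    have "(\<lambda>i. q * q ^ i) sums (q * (1 / (1 - q)))"
      using assms by (intro sums_mult geometric_sums) auto
    then show ?thesis
      using sum_le_suminf[of "\<lambda>i. q ^ Suc i" I] that assms by (simp add: sums_iff)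
  qed
  have fin: "finite (K \<inter> {..<m})" "finite (K \<inter> {m<..})" using assms by auto
  have "(\<Sum>k\<in>K \<inter> {..<m}. ?g k) = (\<Sum>k\<in>K \<inter> {..<m}. q ^ Suc (m - Suc k))"
    by (intro sum.cong arg_cong2[where f = power]) auto
  also have "\<dots> = (\<Sum>i\<in>(\<lambda>k. m - Suc k) ` (K \<inter> {..<m}). q ^ Suc i)"
    by (subst sum.reindex) (auto intro!: inj_onI)
  finally
have low: "(\<Sum>k\<in>K \<inter> {..<m}. ?g k) \<le> q / (1 - q)"
    using geo[of "(\<lambda>k. m - Suc k) ` (K \<inter> {..<m})"] fin by simp
  have "(\<Sum>k\<in>K \<inter> {m<..}. ?g k) = (\<Sum>k\<in>K \<inter> {m<..}. q ^ Suc (k - Suc m))"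
    by (intro sum.cong arg_cong2[where f = power]) auto
  also have "\<dots> = (\<Sum>i\<in>(\<lambda>k. k - Suc m) ` (K \<inter> {m<..}). q ^ Suc i)"
    by (subst sum.reindex) (auto intro!: inj_onI)
  finally
have high: "(\<Sum>k\<in>K \<inter> {m<..}. ?g k) \<le> q / (1 - q)"
    using geo[of "(\<lambda>k. k - Suc m) ` (K \<inter> {m<..})"] fin by simp
  have mid: "(\<Sum>k\<in>K \<inter> {m}. ?g k) \<le> 1"
    by (cases "m \<in> K") auto
  have "(\<Sum>k\<in>K. ?g k) = (\<Sum>k\<in>(K \<inter> {..<m}) \<union> (K \<inter> {m}) \<union> (K \<inter> {m<..}). ?g k)"
    by (rule sum.cong) auto
  also have "\<dots> = (\<Sum>k\<in>K \<inter> {..<m}. ?g k) + (\<Sum>k\<in>K \<inter> {m}. ?g k) + (\<Sum>k\<in>K \<inter> {m<..}. ?g k)"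
    using fin by (subst sum.union_disjoint; (subst sum.union_disjoint)?) auto
  finally show ?thesis using low mid high by simp
qed

text \<open>Let \<open>L * m\<close> be a lattice point nearest to \<open>y\<close>. Its term is at
  most 1; a lattice point \<open>j\<close> steps away from it has distance at least
  \<open>L * j / 2\<close> from \<open>y\<close>, and \<open>j\<close> squared is at least
  \<open>j\<close>, so the Gaussian decays at least geometrically with ratio
  \<open>q\<close>.\<close>

lemma sum_gaussian_lattice_le:
  fixes L y :: real and K :: "nat set"
  assumes "0 < L" "0 \<le> y" "finite K"
  defines "q \<equiv> exp (- (L\<^sup>2 / 8))"
  shows "(\<Sum>k\<in>K. exp (- ((L * real k - y)\<^sup>2 / 2))) \<le> 1 + 2 * (q / (1 - q))"
proof -
  define m where "m = nat (round (y / L))"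
  have rpos: "0 \<le> round (y / L)"
    using round_mono[of 0 "y / L"] assms by simp
  have "\<bar>real m - y / L\<bar> \<le> 1 / 2"
    unfolding m_def using of_int_round_abs_le[of "y / L"] rpos by simp
  then have "L * \<bar>real m - y / L\<bar> \<le> L * (1 / 2)" using assms by (intro mult_left_mono) auto
  moreover have "L * \<bar>real m - y / L\<bar> = \<bar>L * real m - y\<bar>"
    using assms by (simp add: abs_mult_pos' right_diff_distrib)
  ultimately have m: "\<bar>L * real m - y\<bar> \<le> L / 2" by simp
  have "exp (- ((L * real k - y)\<^sup>2 / 2)) \<le> q ^ nat \<bar>int k - int m\<bar>" for k
  proof (cases "k = m")
    case False
    define j where "j = nat \<bar>int k - int m\<bar>"
    have j: "real j = \<bar>real k - real m\<bar>" "1 \<le> real j" using False by (auto simp: j_def)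
    have "L * real j = \<bar>L * real k - L * real m\<bar>"
      using assms by (simp add: j abs_mult_pos' right_diff_distrib)
    also have "\<dots> \<le> \<bar>L * real k - y\<bar> + \<bar>L * real m - y\<bar>" by linarith
    finally have "L * real j - L / 2 \<le> \<bar>L * real k - y\<bar>" using m by linarith
    \<comment> \<open>Since \<open>j\<close> is at least 1, the rounding error \<open>L / 2\<close>
      is at most half of \<open>L * j\<close>.\<close>
    moreover have "L * 1 \<le> L * real j" using j assms by (intro mult_left_mono) auto
    ultimately have "L * real j / 2 \<le> \<bar>L * real k - y\<bar>" by simp
    then have "(L * real j / 2)\<^sup>2 \<le> \<bar>L * real k - y\<bar>\<^sup>2"
      using assms by (intro power_mono) auto
    then have "L\<^sup>2 * (real j)\<^sup>2 / 4 \<le> (L * real k - y)\<^sup>2"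
      by (simp add: power_mult_distrib power_divide)
    moreover have "L\<^sup>2 * real j \<le> L\<^sup>2 * (real j)\<^sup>2"
      using self_le_power[OF j(2), of 2] by (intro mult_left_mono) auto
    ultimately have "real j * (L\<^sup>2 / 8) \<le> (L * real k - y)\<^sup>2 / 2" by (simp add: mult.commute)
    then show ?thesis unfolding q_def j_def[symmetric] by (simp flip: exp_of_nat_mult)
  qed auto
  then have "(\<Sum>k\<in>K. exp (- ((L * real k - y)\<^sup>2 / 2))) \<le> (\<Sum>k\<in>K. q ^ nat \<bar>int k - int m\<bar>)"
    by (intro sum_mono) auto
  also have "\<dots> \<le> 1 + 2 * (q / (1 - q))"
    using assms by (intro sum_geometric_dist_le) (auto simp: q_def)
  finally show ?thesis .
qed

lemma ex_lattice_spacing: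
  fixes n :: nat
  shows "\<exists>L::nat. L > 0 \<and>
    (let q = exp (- ((real L)\<^sup>2 / 8)) in (1 + 2 * (q / (1 - q))) ^ n \<le> 3 / 2)"
proof -
  define F where "F = (\<lambda>L::nat. let q = exp (- ((real L)\<^sup>2 / 8)) in (1 + 2 * (q / (1 - q))) ^ n)"
  have "filterlim (\<lambda>L::nat. (real L)\<^sup>2 * (1/8)) at_top sequentially"
    by (intro filterlim_at_top_mult_tendsto_pos[OF tendsto_const]
        filterlim_pow_at_top filterlim_real_sequentially) auto
  then have q: "((\<lambda>L::nat. exp (- ((real L)\<^sup>2 / 8))) \<longlongrightarrow> 0) sequentially"
    by (intro filterlim_compose[OF exp_at_bot]) (simp add: filterlim_uminus_at_bot)
  have "(F \<longlongrightarrow> (1 + 2 * (0 / (1 - 0))) ^ n) sequentially"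
    unfolding F_def Let_def by (intro tendsto_intros q) auto
  then have "(F \<longlongrightarrow> 1) sequentially" by simp
  then have "eventually (\<lambda>L. F L < 3 / 2) sequentially"
    by (rule order_tendstoD) auto
  with eventually_gt_at_top[of 0] have "eventually (\<lambda>L. 0 < L \<and> F L < 3 / 2) sequentially"
    by eventually_elim auto
  then obtain L where "0 < L" "F L < 3 / 2"
    by (auto simp: eventually_sequentially)
  then show ?thesis by (auto simp: F_def Let_def intro!: exI[of _ L])
qed

text \<open>Square exponents make \<open>sqrt\<close> of the exponent run through the lattice of
  multiples of \<open>L\<close>. The coordinate \<open>i\<close> absorbs the remaining degree, so
  that the total is \<open>N\<close>; on \<open>peak_grid\<close> the subtraction is not
  truncated.\<close>

definition peak_exponent :: "nat \<Rightarrow> nat \<Rightarrow> 'n::finite \<Rightarrow> ('n \<Rightarrow> nat) \<Rightarrow> 'n \<Rightarrow> nat" where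
  "peak_exponent L N i k j =
     (if j = i then N - (\<Sum>l\<in>-{i}. (L * k l)\<^sup>2) else (L * k j)\<^sup>2)"

text \<open>Extensional functions below the cap \<open>N\<close> make this a subset of a finite
  product set, over which a sum of products factors.\<close>

definition peak_grid :: "nat \<Rightarrow> nat \<Rightarrow> 'n::finite \<Rightarrow> ('n \<Rightarrow> nat) set" where
  "peak_grid L N i =
     {k \<in> (-{i}) \<rightarrow>\<^sub>E {..N}. (\<Sum>l\<in>-{i}. (L * k l)\<^sup>2) \<le> N}"

text \<open>These are the moduli of the coordinates at the points of the sphere where the monomial
  with these exponents has its largest modulus.\<close>

definition peak_radius :: "nat \<Rightarrow> nat \<Rightarrow> 'n::finite \<Rightarrow> ('n \<Rightarrow> nat) \<Rightarrow> 'n \<Rightarrow> real" where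
  "peak_radius L N i k j = sqrt (real (peak_exponent L N i k j) / real N)"

text \<open>The division normalises the maximum modulus on the sphere to 1. If an exponent vanishes,
  so does its radius; the quotient is then 0 by convention and its zeroth power is the correct
  factor 1.\<close>

definition peak_monomial ::
    "nat \<Rightarrow> nat \<Rightarrow> 'n::finite \<Rightarrow> ('n \<Rightarrow> nat) \<Rightarrow> complex ^ 'n \<Rightarrow> complex" where
  "peak_monomial L N i k z =
     (\<Prod>j\<in>UNIV. (z $ j / of_real (peak_radius L N i k j)) ^ peak_exponent L N i k j)"

definition peak_poly :: "nat \<Rightarrow> nat \<Rightarrow> 'n::finite \<Rightarrow> complex ^ 'n \<Rightarrow> complex" where
  "peak_poly L N i z = (\<Sum>k\<in>peak_grid L N i. peak_monomial L N i k z)"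

section \<open>Homogeneity and Gaussian domination of the peak monomials\<close>

lemma finite_peak_grid: "finite (peak_grid L N i)"
  unfolding peak_grid_def
  by (rule finite_subset[of _ "(-{i}) \<rightarrow>\<^sub>E {..N}"]) (auto intro!: finite_PiE)

lemma norm_vec_sq: "(norm z)\<^sup>2 = (\<Sum>j\<in>UNIV. (cmod (z $ j))\<^sup>2)" for z :: "complex ^ 'n::finite"
  by (simp add: norm_vec_def L2_set_def sum_nonneg)

lemma sum_UNIV_remove: "(\<Sum>j\<in>UNIV. g j) = g i + (\<Sum>j\<in>-{i}. g j)"
  for i :: "'n::finite" and g :: "'n \<Rightarrow> 'b::comm_monoid_add"
  by (simp add: sum.remove[of UNIV i] Compl_eq_Diff_UNIV)

lemma sum_peak_exponent:
  assumes "k \<in> peak_grid L N i"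
  shows "(\<Sum>j\<in>UNIV. peak_exponent L N i k j) = N"
  using assms by (simp add: sum_UNIV_remove[of _ i] peak_exponent_def peak_grid_def)

lemma sum_peak_radius_sq:
  assumes "k \<in> peak_grid L N i" "0 < N"
  shows "(\<Sum>j\<in>UNIV. (peak_radius L N i k j)\<^sup>2) = 1"
proof -
  have "(\<Sum>j\<in>UNIV. (peak_radius L N i k j)\<^sup>2) = (\<Sum>j\<in>UNIV. real (peak_exponent L N i k j) / real N)"
    by (simp add: peak_radius_def)
  also have "\<dots> = real (\<Sum>j\<in>UNIV. peak_exponent L N i k j) / real N"
    by (simp add: sum_divide_distrib)
  finally show ?thesis using assms by (simp add: sum_peak_exponent)
qed

lemma peak_radius_nonneg: "0 \<le> peak_radius L N i k j"
  by (simp add: peak_radius_def)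

lemma peak_monomial_scale:
  assumes "k \<in> peak_grid L N i"
  shows "peak_monomial L N i k (c *s z) = c ^ N * peak_monomial L N i k z"
proof -
  have "peak_monomial L N i k (c *s z) =
      (\<Prod>j\<in>UNIV. c ^ peak_exponent L N i k j) * peak_monomial L N i k z"
    by (simp add: peak_monomial_def vector_scalar_mult_def flip: prod.distrib power_mult_distrib)
  also have "(\<Prod>j\<in>UNIV. c ^ peak_exponent L N i k j) = c ^ N"
    using assms by (simp add: sum_peak_exponent flip: power_sum)
  finally show ?thesis .
qed

lemma peak_poly_scale: "peak_poly L N i (c *s z) = c ^ N * peak_poly L N i z"
  by (simp add: peak_poly_def peak_monomial_scale sum_distrib_left)

text \<open>From \<open>ln x \<le> x - 1\<close> in each factor; both vectors of moduli have the same length,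
  so the resulting linear exponent is minus half a squared distance.\<close>
lemma norm_peak_monomial_le:
  fixes w :: "complex ^ 'n::finite"
  assumes k: "k \<in> peak_grid L N i" and N: "0 < N" and w: "norm w = 1"
  shows "cmod (peak_monomial L N i k w) \<le>
    (\<Prod>j\<in>-{i}. exp (- ((real L * real (k j) - sqrt (real N) * cmod (w $ j))\<^sup>2 / 2)))"
proof -
  define a where "a = (\<lambda>j. real (peak_exponent L N i k j))"
  define y where "y = (\<lambda>j. sqrt (real N) * cmod (w $ j))"
  have a0: "0 \<le> a j" for j by (simp add: a_def)
  have fac: "cmod ((w $ j / of_real (peak_radius L N i k j)) ^ peak_exponent L N i k j)
      \<le> exp (sqrt (a j) * y j - a j)" for j
  proof (cases "peak_exponent L N i k j = 0")
    case True
    then show ?thesis by (simp add: a_def)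
  next
    case False
    then have ap: "0 < a j" by (simp add: a_def)
    define x where "x = cmod (w $ j) / peak_radius L N i k j"
    have "cmod ((w $ j / of_real (peak_radius L N i k j)) ^ peak_exponent L N i k j)
        = x ^ peak_exponent L N i k j"
      by (simp add: norm_power norm_divide x_def peak_radius_nonneg)
    also have "\<dots> \<le> exp (x - 1) ^ peak_exponent L N i k j"
      using exp_ge_add_one_self[of "x - 1"]
      by (intro power_mono) (auto simp: x_def peak_radius_nonneg)
    also have "\<dots> = exp (a j * (x - 1))"
      by (simp add: a_def exp_of_nat_mult)
    also have "a j * x = sqrt (a j) * y j"
    proof -
      have "x = cmod (w $ j) * sqrt (real N) / sqrt (a j)"
        by (simp add: x_def peak_radius_def a_def real_sqrt_divide)
      moreover have "a j = sqrt (a j) * sqrt (a j)" using ap by simp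
      ultimately have "a j * x = sqrt (a j) * sqrt (a j) * (cmod (w $ j) * sqrt (real N) / sqrt (a j))"
        by simp
      also have "\<dots> = sqrt (a j) * y j"
        unfolding y_def using ap by (simp del: real_sqrt_mult_self)
      finally show ?thesis .
    qed
    then have "a j * (x - 1) = sqrt (a j) * y j - a j" by (simp add: right_diff_distrib)
    finally show ?thesis .
  qed
  have sa: "(\<Sum>j\<in>UNIV. a j) = real N"
    unfolding a_def by (simp flip: of_nat_sum add: sum_peak_exponent[OF k])
  have sy: "(\<Sum>j\<in>UNIV. (y j)\<^sup>2) = real N"
    using norm_vec_sq[of w] w by (simp add: y_def power_mult_distrib flip: sum_distrib_left)
  have "(\<Sum>j\<in>UNIV. (sqrt (a j) - y j)\<^sup>2 / 2)
      = (\<Sum>j\<in>UNIV. (a j + (y j)\<^sup>2) / 2 - sqrt (a j) * y j)"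
    by (rule sum.cong) (auto simp: power2_diff a0 field_simps)
  also have "\<dots> = real N - (\<Sum>j\<in>UNIV. sqrt (a j) * y j)"
    by (simp add: sum_subtractf sum.distrib sa sy flip: sum_divide_distrib)
  finally have ex: "(\<Sum>j\<in>UNIV. sqrt (a j) * y j - a j) = - (\<Sum>j\<in>UNIV. (sqrt (a j) - y j)\<^sup>2 / 2)"
    by (simp add: sum_subtractf sa)
  have "cmod (peak_monomial L N i k w) \<le> (\<Prod>j\<in>UNIV. exp (sqrt (a j) * y j - a j))"
    unfolding peak_monomial_def prod_norm[symmetric] using fac by (intro prod_mono) auto
  also have "\<dots> = exp (- (\<Sum>j\<in>UNIV. (sqrt (a j) - y j)\<^sup>2 / 2))"
    by (simp add: ex flip: exp_sum)
  \<comment> \<open>Only the coordinates other than \<open>i\<close> range over the lattice, so the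
    \<open>i\<close>-th square is dropped.\<close>
  also have "\<dots> \<le> exp (- (\<Sum>j\<in>-{i}. (sqrt (a j) - y j)\<^sup>2 / 2))"
    by (simp add: sum_UNIV_remove[of _ i])
  also have "\<dots> = exp (- (\<Sum>j\<in>-{i}. (real L * real (k j) - y j)\<^sup>2 / 2))"
    by (intro arg_cong[where f = exp] arg_cong[where f = uminus] sum.cong)
      (auto simp: a_def peak_exponent_def)
  also have "\<dots> = (\<Prod>j\<in>-{i}. exp (- ((real L * real (k j) - y j)\<^sup>2 / 2)))"
    unfolding sum_negf[symmetric] by (rule exp_sum) simp
  finally show ?thesis unfolding y_def .
qed

text \<open>The bound \<open>3 / 2\<close> leaves mass \<open>1 / 2\<close> for all terms but one, so the term that peaks at a
  point cannot be cancelled by the others.\<close>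
definition sparse_spacing :: "'n::finite itself \<Rightarrow> nat \<Rightarrow> bool" where
  "sparse_spacing _ L \<longleftrightarrow> 0 < L \<and>
    (let q = exp (- ((real L)\<^sup>2 / 8)) in (1 + 2 * (q / (1 - q))) ^ CARD('n) \<le> 3 / 2)"

text \<open>Enlarging the grid to the full product set turns the sum of products of Gaussians into a
  product of one-dimensional lattice sums, each of which \<open>sum_gaussian_lattice_le\<close>
  bounds independently of \<open>w\<close> and \<open>N\<close>.\<close>

lemma sum_norm_peak_monomial_le:
  fixes w :: "complex ^ 'n::finite"
  assumes L: "sparse_spacing TYPE('n) L" and N: "0 < N" and w: "norm w = 1"
  shows "(\<Sum>k\<in>peak_grid L N i. cmod (peak_monomial L N i k w)) \<le> 3 / 2"
proof -
  define q where "q = exp (- ((real L)\<^sup>2 / 8))"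
  have L0: "0 < L" and Lq: "(1 + 2 * (q / (1 - q))) ^ CARD('n) \<le> 3 / 2"
    using L unfolding sparse_spacing_def q_def Let_def by blast+
  have q: "0 \<le> q" "q < 1" using L0 by (auto simp: q_def)
  define e where "e = (\<lambda>j m. exp (- ((real L * real m - sqrt (real N) * cmod (w $ j))\<^sup>2 / 2)))"
  have "(\<Sum>k\<in>peak_grid L N i. cmod (peak_monomial L N i k w))
      \<le> (\<Sum>k\<in>peak_grid L N i. \<Prod>j\<in>-{i}. e j (k j))"
    unfolding e_def by (intro sum_mono norm_peak_monomial_le N w)
  also have "\<dots> \<le> (\<Sum>k\<in>(-{i}) \<rightarrow>\<^sub>E {..N}. \<Prod>j\<in>-{i}. e j (k j))"
  proof (rule sum_mono2)
    show "finite ((-{i}) \<rightarrow>\<^sub>E {..N})" by (rule finite_PiE) auto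
    show "peak_grid L N i \<subseteq> (-{i}) \<rightarrow>\<^sub>E {..N}" unfolding peak_grid_def by blast
    show "0 \<le> (\<Prod>j\<in>-{i}. e j (k j))" for k unfolding e_def by (intro prod_nonneg) simp
  qed
  also have "\<dots> = (\<Prod>j\<in>-{i}. \<Sum>m\<in>{..N}. e j m)"
    by (rule prod_sum_PiE[symmetric]) auto
  also have "\<dots> \<le> (\<Prod>j\<in>-{i}. 1 + 2 * (q / (1 - q)))"
    unfolding e_def q_def using L0
    by (intro prod_mono conjI sum_gaussian_lattice_le sum_nonneg) auto
  also have "\<dots> = (1 + 2 * (q / (1 - q))) ^ card (-{i})"
    by simp
  also have "\<dots> \<le> (1 + 2 * (q / (1 - q))) ^ CARD('n)"
    using q by (intro power_increasing card_mono) auto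
  also note Lq
  finally show ?thesis .
qed

lemma norm_peak_poly_le:
  fixes z :: "complex ^ 'n::finite"
  assumes L: "sparse_spacing TYPE('n) L" and N: "0 < N"
  shows "cmod (peak_poly L N i z) \<le> 3 / 2 * norm z ^ N"
proof -
  have unit: "cmod (peak_poly L N i w) \<le> 3 / 2" if "norm w = 1" for w
    unfolding peak_poly_def by (rule order_trans[OF norm_sum sum_norm_peak_monomial_le[OF L N that]])
  obtain w :: "complex ^ 'n" where w: "norm w = 1" and z: "z = of_real (norm z) *s w"
  proof (cases "z = 0")
    case True
    obtain w :: "complex ^ 'n" where "norm w = 1" using vector_choose_size[of 1] by auto
    then show ?thesis using that[of w] True by simp
  next
    case False
    then show ?thesis
      by (intro that[of "sgn z"])
        (simp_all add: norm_sgn, simp add: sgn_div_norm vec_eq_iff scaleR_conv_of_real[where 'a = complex])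
  qed
  have "cmod (peak_poly L N i z) = norm z ^ N * cmod (peak_poly L N i w)"
    by (subst z) (simp add: peak_poly_scale norm_mult norm_power)
  also have "\<dots> \<le> norm z ^ N * (3 / 2)" by (intro mult_left_mono unit w) auto
  finally show ?thesis by simp
qed

text \<open>One monomial has modulus exactly 1 and the moduli of all of them add up to at most 3/2,
  so the others cancel at most 1/2. Only the moduli of \<open>w\<close> are prescribed, which leaves
  its phases free to be matched with a boundary point.\<close>

lemma norm_peak_poly_ge:
  fixes w :: "complex ^ 'n::finite"
  assumes L: "sparse_spacing TYPE('n) L" and N: "0 < N" and k: "k \<in> peak_grid L N i"
    and w: "\<And>j. cmod (w $ j) = peak_radius L N i k j"
  shows "1 / 2 \<le> cmod (peak_poly L N i w)"
proof -
  have "(norm w)\<^sup>2 = 1" by (simp add: norm_vec_sq w sum_peak_radius_sq k N)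
  then have nw: "norm w = 1" by (simp add: power2_eq_1_iff) (use norm_ge_zero[of w] in linarith)
  have one: "cmod (peak_monomial L N i k w) = 1"
  proof -
    have "cmod ((w $ j / of_real (peak_radius L N i k j)) ^ peak_exponent L N i k j) = 1" for j
    proof (cases "peak_exponent L N i k j = 0")
      case False
      then have "peak_radius L N i k j > 0" using N by (simp add: peak_radius_def)
      then show ?thesis by (simp add: norm_power norm_divide w)
    qed simp
    then show ?thesis unfolding peak_monomial_def prod_norm[symmetric] by simp
  qed
  let ?R = "\<Sum>l\<in>peak_grid L N i - {k}. peak_monomial L N i l w"
  have "cmod ?R \<le> (\<Sum>l\<in>peak_grid L N i - {k}. cmod (peak_monomial L N i l w))"
    by (rule norm_sum)
  also have "\<dots> = (\<Sum>l\<in>peak_grid L N i. cmod (peak_monomial L N i l w)) - 1"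
    using k one by (simp add: sum_diff1 finite_peak_grid)
  also have "\<dots> \<le> 1 / 2" using sum_norm_peak_monomial_le[OF L N nw] by (simp add: algebra_simps)
  finally have R: "cmod ?R \<le> 1 / 2" .
  have "peak_poly L N i w = peak_monomial L N i k w + ?R"
    unfolding peak_poly_def by (rule sum.remove[OF finite_peak_grid k])
  then show ?thesis
    using R one norm_diff_ineq[of "peak_monomial L N i k w" ?R] by simp
qed

text \<open>For \<open>j \<noteq> i\<close> the point is rounded down to the lattice; maximality of the \<open>i\<close>-th modulus
  keeps the resulting error in the remaining exponent under control.\<close>
lemma ex_near_peak:
  fixes \<zeta> :: "complex ^ 'n::finite"
  assumes L: "0 < L" and N: "0 < N" and \<zeta>: "norm \<zeta> = 1"
    and max: "\<And>j. cmod (\<zeta> $ j) \<le> cmod (\<zeta> $ i)"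
  shows "\<exists>k\<in>peak_grid L N i. (\<Sum>j\<in>UNIV. (peak_radius L N i k j - cmod (\<zeta> $ j))\<^sup>2)
    \<le> real CARD('n) * (2 * real CARD('n) * real L)\<^sup>2 / real N"
proof -
  define n where "n = real CARD('n)"
  have n1: "1 \<le> n"
    using zero_less_card_finite[where 'a = 'n] by (simp add: n_def Suc_le_eq)
  define y where "y = (\<lambda>j. sqrt (real N) * cmod (\<zeta> $ j))"
  define k where "k = restrict (\<lambda>j. nat \<lfloor>y j / real L\<rfloor>) (-{i})"
  have y0: "0 \<le> y j" for j by (simp add: y_def)
  have sy: "(\<Sum>j\<in>UNIV. (y j)\<^sup>2) = real N"
    using norm_vec_sq[of \<zeta>] \<zeta> by (simp add: y_def power_mult_distrib flip: sum_distrib_left)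
  have sy': "(\<Sum>j\<in>-{i}. (y j)\<^sup>2) = real N - (y i)\<^sup>2"
    using sy by (simp add: sum_UNIV_remove[of _ i])
  have yi: "y j \<le> y i" for j unfolding y_def by (intro mult_left_mono max) auto
  have kle: "real L * real (k j) \<le> y j" and kgt: "y j - real L * real (k j) \<le> real L"
    if "j \<noteq> i" for j
  proof -
    have "real (k j) = of_int \<lfloor>y j / real L\<rfloor>"
      using that y0[of j] L by (simp add: k_def)
    then have "real (k j) \<le> y j / real L" "y j / real L \<le> real (k j) + 1"
      by linarith+
    then show "real L * real (k j) \<le> y j" "y j - real L * real (k j) \<le> real L"
      using L by (simp_all add: field_simps)
  qed
  have ksum: "(\<Sum>j\<in>-{i}. (real L * real (k j))\<^sup>2) \<le> real N - (y i)\<^sup>2"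
    unfolding sy'[symmetric] using kle by (intro sum_mono power_mono) auto
  have ksumN: "(\<Sum>j\<in>-{i}. (L * k j)\<^sup>2) \<le> N"
  proof -
    have "real (\<Sum>j\<in>-{i}. (L * k j)\<^sup>2) \<le> real N"
      using ksum by (simp, smt (verit) zero_le_power2)
    then show ?thesis by linarith
  qed
  have kN: "k j \<le> N" if "j \<noteq> i" for j
  proof -
    have "real (k j) \<le> real L * real (k j)"
      using L mult_right_mono[of 1 "real L" "real (k j)"] by simp
    also have "\<dots> \<le> y j" by (rule kle[OF that])
    also have "\<dots> \<le> sqrt (real N) * 1"
      unfolding y_def using Finite_Cartesian_Product.norm_nth_le[of \<zeta> j] \<zeta>
      by (intro mult_left_mono) auto
    also have "\<dots> \<le> sqrt (real N) * sqrt (real N)"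
      using N by (intro mult_left_mono) auto
    finally show ?thesis by simp
  qed
  have grid: "k \<in> peak_grid L N i"
    using ksumN kN by (auto simp: peak_grid_def k_def)
  define a where "a = (\<lambda>j. real (peak_exponent L N i k j))"
  have aj: "sqrt (a j) = real L * real (k j)" if "j \<noteq> i" for j
    using that by (simp add: a_def peak_exponent_def)
  have ai: "a i = real N - (\<Sum>j\<in>-{i}. (real L * real (k j))\<^sup>2)"
    using ksumN by (simp add: a_def peak_exponent_def of_nat_diff)
  have close: "\<bar>sqrt (a j) - y j\<bar> \<le> 2 * n * real L" for j
  proof (cases "j = i")
    case False
    have "real L * 1 \<le> real L * (2 * n)" using n1 by (intro mult_left_mono) auto
    then show ?thesis using kle[OF False] kgt[OF False] aj[OF False] by (simp add: mult_ac)
  next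
    case True
    \<comment> \<open>Needed in order to cancel \<open>y i\<close> below: a vanishing largest
      coordinate would force all of them to vanish.\<close>
    have ypos: "0 < y i"
    proof (rule ccontr)
      assume "\<not> 0 < y i"
      then have "y j = 0" for j using yi[of j] y0[of j] by linarith
      then show False using sy N by simp
    qed
    have lo: "(y i)\<^sup>2 \<le> a i" using ai ksum by simp
    have "a i - (y i)\<^sup>2 = (\<Sum>j\<in>-{i}. (y j)\<^sup>2 - (real L * real (k j))\<^sup>2)"
      using sy' ai by (simp add: sum_subtractf)
    also have "\<dots> \<le> (\<Sum>j\<in>-{i}. real L * (2 * y i))"
    proof (rule sum_mono)
      fix j assume "j \<in> -{i}"
      then have j: "j \<noteq> i" by simp
      have "(y j)\<^sup>2 - (real L * real (k j))\<^sup>2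
          = (y j - real L * real (k j)) * (y j + real L * real (k j))"
        by (simp add: power2_eq_square algebra_simps)
      also have "\<dots> \<le> real L * (2 * y i)"
        using kle[OF j] kgt[OF j] yi[of j] y0[of j] by (intro mult_mono) auto
      finally show "(y j)\<^sup>2 - (real L * real (k j))\<^sup>2 \<le> real L * (2 * y i)" .
    qed
    also have "\<dots> = real (card (-{i})) * (real L * (2 * y i))" by simp
    also have "\<dots> \<le> n * (real L * (2 * y i))"
      unfolding n_def using ypos by (intro mult_right_mono) (auto intro!: card_mono)
    finally have up: "a i - (y i)\<^sup>2 \<le> (2 * n * real L) * y i" by (simp add: mult_ac)
    have ge: "y i \<le> sqrt (a i)" using lo by (rule real_le_rsqrt)
    \<comment> \<open>The defect of the squares is at most a multiple of \<open>y i\<close>, and the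
      second factor here is at least \<open>y i\<close>; cancelling it bounds the difference of the
      square roots independently of \<open>N\<close>.\<close>
    have "a i - (y i)\<^sup>2 = (sqrt (a i) - y i) * (sqrt (a i) + y i)"
    proof -
      have "u\<^sup>2 - v\<^sup>2 = (u - v) * (u + v)" for u v :: real
        by (simp add: power2_eq_square algebra_simps)
      from this[of "sqrt (a i)" "y i"] show ?thesis by (simp add: a_def)
    qed
    moreover have "(sqrt (a i) - y i) * y i \<le> (sqrt (a i) - y i) * (sqrt (a i) + y i)"
      using ge y0[of i] by (intro mult_left_mono) (auto simp: a_def)
    ultimately have "(sqrt (a i) - y i) * y i \<le> (2 * n * real L) * y i" using up by linarith
    then have "sqrt (a i) - y i \<le> 2 * n * real L" using ypos by simp
    then show ?thesis using True ge by simp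
  qed
  have "(\<Sum>j\<in>UNIV. (peak_radius L N i k j - cmod (\<zeta> $ j))\<^sup>2)
      = (\<Sum>j\<in>UNIV. (sqrt (a j) - y j)\<^sup>2 / real N)"
  proof (rule sum.cong)
    fix j
    have "peak_radius L N i k j - cmod (\<zeta> $ j) = (sqrt (a j) - y j) / sqrt (real N)"
      using N by (simp add: peak_radius_def a_def y_def real_sqrt_divide field_simps)
    then show "(peak_radius L N i k j - cmod (\<zeta> $ j))\<^sup>2 = (sqrt (a j) - y j)\<^sup>2 / real N"
      by (simp add: power_divide)
  qed simp
  also have "\<dots> \<le> (\<Sum>j\<in>(UNIV :: 'n set). (2 * n * real L)\<^sup>2 / real N)"
    by (intro sum_mono divide_right_mono abs_le_square_iff[THEN iffD1] order_trans[OF close abs_ge_self])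
      auto
  also have "\<dots> = n * (2 * n * real L)\<^sup>2 / real N" by (simp add: n_def)
  finally show ?thesis using grid unfolding n_def by blast
qed

text \<open>Bernoulli's inequality with the full exponent gives only 0; with half the exponent it
  gives 1/2, which is then squared.\<close>

lemma one_minus_inverse_power_ge:
  fixes N :: nat
  assumes "even N" "0 < N"
  shows "1 / 4 \<le> (1 - 1 / real N) ^ N"
proof -
  obtain M where M: "N = 2 * M" using assms by blast
  then have "0 < M" using assms by simp
  have "1 + real M * (- (1 / real N)) \<le> (1 + (- (1 / real N))) ^ M"
    using assms by (intro Bernoulli_inequality) (auto simp: divide_simps)
  then have "1 / 2 \<le> (1 - 1 / real N) ^ M" using \<open>0 < M\<close> by (simp add: M)
  then have "(1 / 2)\<^sup>2 \<le> ((1 - 1 / real N) ^ M)\<^sup>2" by (intro power_mono) auto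
  then show ?thesis
    unfolding power_mult[symmetric] using M by (simp add: mult.commute power_divide)
qed

text \<open>The point \<open>w\<close> takes its moduli from a nearby peak and its phases from
  \<zeta>. Its Hermitian product with \<zeta> is then real and equals \<open>1 - S / 2\<close>,
  where \<open>S\<close> is the squared distance of the two vectors of moduli, of order 1/N.
  Shrinking \<open>w\<close> by the factor \<open>1 - 1 / N\<close> reaches depth 1/N and, by
  homogeneity, keeps at least a quarter of the value.\<close>

lemma ex_koranyi_peak:
  fixes \<zeta> :: "complex ^ 'n::finite"
  assumes L: "sparse_spacing TYPE('n) L" and N: "even N" "0 < N" and \<zeta>: "norm \<zeta> = 1"
    and max: "\<And>j. cmod (\<zeta> $ j) \<le> cmod (\<zeta> $ i)"
  shows "\<exists>z\<in>koranyi_region (2 + real CARD('n) * (2 * real CARD('n) * real L)\<^sup>2 / 2) \<zeta>.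
    norm z = 1 - 1 / real N \<and> 1 / 8 \<le> cmod (peak_poly L N i z)"
proof -
  define C where "C = real CARD('n) * (2 * real CARD('n) * real L)\<^sup>2"
  have L0: "0 < L" using L by (simp add: sparse_spacing_def)
  obtain k where k: "k \<in> peak_grid L N i"
    and near: "(\<Sum>j\<in>UNIV. (peak_radius L N i k j - cmod (\<zeta> $ j))\<^sup>2) \<le> C / real N"
    using ex_near_peak[OF L0 N(2) \<zeta> max] unfolding C_def by blast
  define s where "s = peak_radius L N i k"
  define r where "r = 1 - 1 / real N"
  have r: "0 \<le> r" "r < 1" using N by (auto simp: r_def)
  \<comment> \<open>Where a coordinate of \<zeta> vanishes, \<open>sgn\<close> would be 0 and spoil
    the modulus; the phase 1 is used there instead.\<close>
  define w where "w = (\<chi> j. of_real (s j) * (if \<zeta> $ j = 0 then 1 else sgn (\<zeta> $ j)))"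
  have w: "cmod (w $ j) = s j" for j
    by (simp add: w_def norm_mult s_def peak_radius_nonneg norm_sgn)
  have ss: "(\<Sum>j\<in>UNIV. (s j)\<^sup>2) = 1" unfolding s_def by (rule sum_peak_radius_sq[OF k N(2)])
  have "(norm w)\<^sup>2 = 1" by (simp add: norm_vec_sq w ss)
  then have nw: "norm w = 1" by (simp add: power2_eq_1_iff) (use norm_ge_zero[of w] in linarith)
  define z where "z = of_real r *s w"
  have nz: "norm z = r" using r nw by (simp add: z_def norm_smult_vec)
  define S where "S = (\<Sum>j\<in>UNIV. (s j - cmod (\<zeta> $ j))\<^sup>2)"
  have term_eq: "w $ j * cnj (\<zeta> $ j) = of_real (s j * cmod (\<zeta> $ j))" for j
  proof (cases "\<zeta> $ j = 0")
    case False
    have "sgn (\<zeta> $ j) * cnj (\<zeta> $ j) = \<zeta> $ j * cnj (\<zeta> $ j) / of_real (cmod (\<zeta> $ j))"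
      by (simp add: sgn_eq)
    also have "\<dots> = of_real (cmod (\<zeta> $ j))"
      using False by (simp add: power2_eq_square flip: complex_norm_square)
    finally show ?thesis using False by (simp add: w_def mult.assoc)
  qed (simp add: w_def)
  have "S = (\<Sum>j\<in>UNIV. (s j)\<^sup>2) + (\<Sum>j\<in>UNIV. (cmod (\<zeta> $ j))\<^sup>2) - 2 * (\<Sum>j\<in>UNIV. s j * cmod (\<zeta> $ j))"
    by (simp add: S_def power2_diff sum_subtractf sum.distrib sum_distrib_left mult.assoc)
  moreover have "(\<Sum>j\<in>UNIV. (cmod (\<zeta> $ j))\<^sup>2) = 1" using norm_vec_sq[of \<zeta>] \<zeta> by simp
  ultimately have dotsum: "(\<Sum>j\<in>UNIV. s j * cmod (\<zeta> $ j)) = 1 - S / 2"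
    using ss by linarith
  have "hermitian_dot z \<zeta> = of_real r * (\<Sum>j\<in>UNIV. w $ j * cnj (\<zeta> $ j))"
    by (simp add: hermitian_dot_def z_def sum_distrib_left mult.assoc)
  also have "\<dots> = of_real (r * (1 - S / 2))"
    unfolding term_eq dotsum[symmetric] by simp
  finally have "1 - hermitian_dot z \<zeta> = of_real (1 - r * (1 - S / 2))" by simp
  then have "cmod (1 - hermitian_dot z \<zeta>) = \<bar>1 - r * (1 - S / 2)\<bar>"
    by (simp only: norm_of_real)
  also have "1 - r * (1 - S / 2) = (1 - r) + r * (S / 2)" by (simp add: algebra_simps)
  also have "\<bar>\<dots>\<bar> = (1 - r) + r * (S / 2)"
    using r by (intro abs_of_nonneg) (auto simp: S_def intro!: add_nonneg_nonneg mult_nonneg_nonneg sum_nonneg)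
  also have "\<dots> \<le> (1 - r) + 1 * (S / 2)"
    using r by (intro add_left_mono mult_right_mono) (auto simp: S_def intro!: sum_nonneg)
  also have "\<dots> \<le> 1 / real N + C / real N / 2" using near by (simp add: S_def s_def r_def)
  \<comment> \<open>The estimate needs aperture \<open>1 + C / 2\<close>; the additional 1 gives
    strictness.\<close>
  also have "\<dots> < (2 + C / 2) * (1 / real N)" using N by (simp add: field_simps)
  finally have "z \<in> koranyi_region (2 + C / 2) \<zeta>"
    using nz r by (simp add: koranyi_region_def r_def)
  moreover have "1 / 8 \<le> cmod (peak_poly L N i z)"
  proof -
    have "1 / 2 \<le> cmod (peak_poly L N i w)"
      by (rule norm_peak_poly_ge[OF L N(2) k]) (simp add: w s_def)
    moreover have "1 / 4 \<le> r ^ N" unfolding r_def by (rule one_minus_inverse_power_ge[OF N])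
    ultimately have "1 / 4 * (1 / 2) \<le> r ^ N * cmod (peak_poly L N i w)"
      using r by (intro mult_mono) auto
    also have "\<dots> = cmod (peak_poly L N i z)"
      using r by (simp add: z_def peak_poly_scale norm_mult norm_power)
    finally show ?thesis by simp
  qed
  ultimately show ?thesis using nz unfolding C_def r_def by blast
qed

section \<open>Radial estimates\<close>

text \<open>This is \<open>u \<le> exp u\<close> at \<open>u = c * x / p\<close>, raised to the
  power \<open>p\<close>.\<close>

lemma powr_mult_exp_le:
  fixes x p c :: real
  assumes "0 \<le> x" "0 < p" "0 < c"
  shows "x powr p * exp (- (c * x)) \<le> (p / c) powr p"
proof -
  have "c * x / p \<le> exp (c * x / p)"
    using exp_ge_add_one_self[of "c * x / p"] by linarith
  then have "x \<le> p / c * exp (c * x / p)" using assms by (simp add: field_simps)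
  then have "x powr p \<le> (p / c * exp (c * x / p)) powr p"
    using assms by (intro powr_mono2) auto
  also have "\<dots> = (p / c) powr p * exp (c * x / p) powr p"
    by (rule powr_mult)
  also have "exp (c * x / p) powr p = exp (c * x)"
    using assms by (simp add: powr_def)
  finally show ?thesis using assms by (simp add: exp_minus field_simps)
qed

lemma power_le_exp: "0 \<le> x \<Longrightarrow> x ^ n \<le> exp (- (real n * (1 - x)))" for x :: real
proof -
  assume "0 \<le> x"
  then have "x ^ n \<le> exp (x - 1) ^ n"
    using exp_ge_add_one_self[of "x - 1"] by (intro power_mono) auto
  then show ?thesis by (simp add: algebra_simps flip: exp_of_nat_mult)
qed

text \<open>Volumes of balls scale with the dimension as exponent, and on the unit interval such a
  power has Lipschitz constant at most the dimension.\<close>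

lemma emeasure_shell_le:
  fixes r s :: real
  assumes "0 \<le> r" "r \<le> s" "s \<le> 1"
  shows "emeasure lborel (ball (0::'a::euclidean_space) s - ball 0 r)
    \<le> ennreal (real DIM('a) * measure lborel (ball (0::'a) 1) * (s - r))"
proof -
  let ?V = "measure lborel (ball (0::'a) 1)"
  have "emeasure lborel (ball (0::'a) s - ball 0 r)
      = emeasure lborel (ball (0::'a) s) - emeasure lborel (ball (0::'a) r)"
    using assms emeasure_lborel_ball_finite[of "0::'a" r]
    by (intro emeasure_Diff) (auto simp: subset_ball)
  also have "\<dots> = ennreal (measure lborel (ball (0::'a) s) - measure lborel (ball (0::'a) r))"
    using emeasure_lborel_ball_finite[of "0::'a"]
    by (simp add: emeasure_eq_ennreal_measure ennreal_minus less_top)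
  also have "measure lborel (ball (0::'a) s) - measure lborel (ball (0::'a) r) = (s ^ DIM('a) - r ^ DIM('a)) * ?V"
    using assms content_ball_conv_unit_ball[of s "0::'a"] content_ball_conv_unit_ball[of r "0::'a"]
    by (simp add: left_diff_distrib)
  also have "\<dots> \<le> (real DIM('a) * (s - r)) * ?V"
  proof (rule mult_right_mono)
    show "s ^ DIM('a) - r ^ DIM('a) \<le> real DIM('a) * (s - r)"
      using norm_power_diff[of s r "DIM('a)"] assms by (simp add: abs_le_iff)
  qed simp
  finally show ?thesis by (simp add: mult_ac ennreal_leI)
qed

text \<open>Dyadic shells; with \<open>x = 2\<^sup>k\<^sup>-\<^sup>j\<close> the \<open>j\<close>-th shell contributes a multiple of
  \<open>2\<^sup>-\<^sup>k\<^sup>b x\<^sup>b exp (- x / 2)\<close>, and \<open>x\<^sup>b exp (- x / 2)\<close> is dominated by both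
  \<open>x\<^sup>b\<close> and a multiple of \<open>x\<^sup>-\<^sup>b\<close>.\<close>
lemma nn_integral_norm_power_weight_le:
  fixes b :: real
  assumes b: "0 < b"
  shows "\<exists>K\<ge>0. \<forall>k. (\<integral>\<^sup>+ z \<in> ball (0::'a::euclidean_space) 1.
      ennreal (norm z ^ (2 ^ k) * (1 - norm z) powr (b - 1)) \<partial>lborel)
    \<le> ennreal (K * (2 ^ k) powr (- b))"
proof -
  define V where "V = real DIM('a) * measure lborel (ball (0::'a) 1)"
  have V: "0 \<le> V" by (simp add: V_def)
  \<comment> \<open>\<open>C\<close> bounds the variation of the weight within one shell: the ratio
    of \<delta> to \<open>d j\<close> lies between 1/2 and 1, so its power \<open>b - 1\<close> is
    at most 1 for \<open>b \<ge> 1\<close> and at most \<open>2 powr (1 - b)\<close>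
    otherwise.\<close>
  define C where "C = 1 + 2 powr (1 - b)"
  have C: "0 \<le> C" by (simp add: C_def)
  \<comment> \<open>The second summand is the bound from \<open>powr_mult_exp_le\<close> for
    \<open>x powr (2 * b) * exp (- (x / 2))\<close>, which yields the decay
    \<open>x powr (- b)\<close> for large \<open>x\<close>.\<close>
  define E where "E = 1 + (2 * b / (1 / 2)) powr (2 * b)"
  have E: "0 \<le> E" by (simp add: E_def)
  define \<rho> where "\<rho> = (1 / 2 :: real) powr b"
  have \<rho>: "0 \<le> \<rho>" "\<rho> < 1" using b by (auto simp: \<rho>_def powr_def ln_div)
  define K where "K = C * V * E * (1 + 2 * (\<rho> / (1 - \<rho>)))"
  have K: "0 \<le> K" using V C E \<rho> by (simp add: K_def)
  have phi: "x powr b * exp (- (x / 2)) \<le> E * x powr b" 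
    "x powr b * exp (- (x / 2)) \<le> E * x powr (- b)" if "0 < x" for x :: real
  proof -
    have "x powr b * exp (- (x / 2)) \<le> x powr b * 1"
      using that by (intro mult_left_mono) auto
    also have "\<dots> \<le> E * x powr b" by (simp add: E_def algebra_simps)
    finally show "x powr b * exp (- (x / 2)) \<le> E * x powr b" .
    have "x powr b * exp (- (x / 2)) = x powr (2 * b) * exp (- (1 / 2 * x)) * x powr (- b)"
      using that by (simp flip: powr_add)
    also have "\<dots> \<le> (2 * b / (1 / 2)) powr (2 * b) * x powr (- b)"
      using that b by (intro mult_right_mono powr_mult_exp_le) auto
    also have "\<dots> \<le> E * x powr (- b)" by (intro mult_right_mono) (auto simp: E_def)
    finally show "x powr b * exp (- (x / 2)) \<le> E * x powr (- b)" .
  qed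
  define d where "d = (\<lambda>j::nat. (1 / 2 :: real) ^ j)"
  have d: "0 < d j" "d j \<le> 1" for j by (auto simp: d_def power_le_one)
  \<comment> \<open>The shell on which the distance to the sphere lies in the half-open interval
    from \<open>d j / 2\<close>, excluded, to \<open>d j\<close>, included. These shells cover the
    ball; for \<open>j = 0\<close> the removed ball is empty.\<close>
  define B where "B = (\<lambda>j. ball (0::'a) (1 - d j / 2) - ball 0 (1 - d j))"
  have [measurable]: "B j \<in> sets borel" for j by (auto simp: B_def)
  have meas: "emeasure lborel (B j) \<le> ennreal (V * d j)" for j
  proof -
    have "emeasure lborel (B j) \<le> ennreal (V * ((1 - d j / 2) - (1 - d j)))"
      unfolding B_def V_def using d[of j] by (intro emeasure_shell_le) auto
    also have "\<dots> \<le> ennreal (V * d j)"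
      using V d[of j] by (intro ennreal_leI mult_left_mono) auto
    finally show ?thesis .
  qed
  have "(\<integral>\<^sup>+ z \<in> ball (0::'a) 1. ennreal (norm z ^ (2 ^ k) * (1 - norm z) powr (b - 1)) \<partial>lborel)
      \<le> ennreal (K * (2 ^ k) powr (- b))" for k
  proof -
    define N where "N = (2::nat) ^ k"
    have N: "0 < N" by (simp add: N_def)
    define c where "c = (\<lambda>j. C * d j powr (b - 1) * exp (- (real N * d j / 2)))"
    have c: "0 \<le> c j" for j using C by (simp add: c_def)
    have pt: "ennreal (norm z ^ N * (1 - norm z) powr (b - 1)) * indicator (ball 0 1) z
        \<le> (\<Sum>j. ennreal (c j) * indicator (B j) z)" for z :: 'a
    proof (cases "norm z < 1")
      case True
      define \<delta> where "\<delta> = 1 - norm z"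
      have \<delta>: "0 < \<delta>" "\<delta> \<le> 1" using True by (auto simp: \<delta>_def)
      obtain J where "d J < \<delta>"
        using real_arch_pow_inv[OF \<delta>(1), of "1 / 2"] unfolding d_def by auto
      moreover have "d (Suc J) \<le> d J" unfolding d_def by simp
      ultimately have "d (Suc J) < \<delta>" by linarith
      then have ex: "\<exists>j. d (Suc j) < \<delta>" by blast
      \<comment> \<open>Minimality supplies the upper bound \<open>\<delta> \<le> d j\<close> and
        thus places \<open>z\<close> in the shell \<open>B j\<close>.\<close>
      define j where "j = (LEAST j. d (Suc j) < \<delta>)"
      have j1: "d (Suc j) < \<delta>" unfolding j_def by (rule LeastI_ex[OF ex])
      have j2: "\<delta> \<le> d j"
      proof (cases j)
        case 0
        then show ?thesis using \<delta> by (simp add: d_def)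
      next
        case (Suc i)
        then have "\<not> d (Suc i) < \<delta>" unfolding j_def by (intro not_less_Least) simp
        then show ?thesis using Suc by simp
      qed
      have jS: "d j / 2 < \<delta>" using j1 by (simp add: d_def)
      have zB: "z \<in> B j" using jS j2 by (simp add: B_def \<delta>_def)
      have "\<delta> powr (b - 1) \<le> C * d j powr (b - 1)"
      proof -
        define u where "u = \<delta> / d j"
        have u: "1 / 2 \<le> u" "u \<le> 1" using jS j2 d[of j] by (auto simp: u_def field_simps)
        have "u powr (b - 1) \<le> C"
        proof (cases "1 \<le> b")
          case True
          then have "u powr (b - 1) \<le> 1" using u by (intro powr_le1) auto
          then show ?thesis by (simp add: C_def add_increasing2)
        next
          case False
          have "u powr (b - 1) \<le> (1 / 2) powr (b - 1)" using u False by (intro powr_mono2') auto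
          also have "\<dots> = 2 powr (1 - b)" by (simp add: powr_divide powr_diff)
          finally show ?thesis by (simp add: C_def)
        qed
        then have "d j powr (b - 1) * u powr (b - 1) \<le> d j powr (b - 1) * C"
          by (intro mult_left_mono) auto
        moreover have "\<delta> powr (b - 1) = d j powr (b - 1) * u powr (b - 1)"
          using d[of j] \<delta> by (simp add: u_def flip: powr_mult)
        ultimately show ?thesis by (simp add: mult.commute)
      qed
      moreover have "norm z ^ N \<le> exp (- (real N * d j / 2))"
      proof -
        have "norm z ^ N \<le> exp (- (real N * \<delta>))" unfolding \<delta>_def by (rule power_le_exp) simp
        also have "\<dots> \<le> exp (- (real N * (d j / 2)))" using jS N by simp
        finally show ?thesis by simp
      qed
      ultimately have "norm z ^ N * \<delta> powr (b - 1) \<le> exp (- (real N * d j / 2)) * (C * d j powr (b - 1))"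
        by (intro mult_mono) auto
      then have "ennreal (norm z ^ N * \<delta> powr (b - 1)) \<le> ennreal (c j) * indicator (B j) z"
        using zB by (simp add: c_def mult_ac ennreal_leI)
      also have "\<dots> \<le> (\<Sum>j. ennreal (c j) * indicator (B j) z)"
      proof -
        have "g j \<le> suminf g" for g :: "nat \<Rightarrow> ennreal"
          using sum_le_suminf[of g "{j}"] by simp
        then show ?thesis .
      qed
      finally show ?thesis using True by (simp add: \<delta>_def)
    qed simp
    have "(\<integral>\<^sup>+ z \<in> ball (0::'a) 1. ennreal (norm z ^ N * (1 - norm z) powr (b - 1)) \<partial>lborel)
        \<le> (\<integral>\<^sup>+ z. (\<Sum>j. ennreal (c j) * indicator (B j) z) \<partial>lborel)"
      by (intro nn_integral_mono pt)
    also have "\<dots> = (\<Sum>j. ennreal (c j) * emeasure lborel (B j))"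
      by (subst nn_integral_suminf) (measurable, simp add: nn_integral_cmult_indicator)
    also have "\<dots> \<le> (\<Sum>j. ennreal (c j * (V * d j)))"
      using meas c by (intro suminf_le summableI) (auto simp: ennreal_mult' intro!: mult_left_mono)
    also have "\<dots> \<le> ennreal (K * real N powr (- b))"
    proof (rule suminf_le_const)
      fix n :: nat
      have cj: "c j * (V * d j) \<le> C * V * E * real N powr (- b) * \<rho> ^ nat \<bar>int j - int k\<bar>" for j
      proof -
        define x where "x = real N * d j"
        have x: "0 < x" using N d by (simp add: x_def)
        have "d j powr (b - 1) * d j = d j powr b" using d[of j] by (simp add: powr_diff)
        moreover have "d j powr b = real N powr (- b) * x powr b"
          using N d[of j] by (simp add: x_def powr_mult powr_minus field_simps)
        ultimately have eq: "c j * (V * d j) = C * V * real N powr (- b) * (x powr b * exp (- (x / 2)))"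
          by (simp add: c_def x_def mult_ac)
        \<comment> \<open>Here \<open>x\<close> is 2 to the power \<open>k - j\<close>. For
          \<open>j \<le> k\<close> it is at least 1 and the decaying bound is used; for
          \<open>j > k\<close> it is small and \<open>x powr b\<close> itself decays. Both give
          \<open>\<rho>\<close> to the power of the distance of \<open>j\<close> and
          \<open>k\<close>.\<close>
        have "x powr b * exp (- (x / 2)) \<le> E * \<rho> ^ nat \<bar>int j - int k\<bar>"
        proof (cases "j \<le> k")
          case True
          then have "1 / x = (1 / 2) ^ (k - j)"
            by (simp add: x_def N_def d_def power_divide power_diff)
          then have "x powr (- b) = ((1 / 2) ^ (k - j)) powr b"
            using x by (metis powr_minus_divide powr_divide powr_one_eq_one)
          also have "\<dots> = \<rho> ^ (k - j)" by (simp add: \<rho>_def powr_power powr_powr mult.commute flip: powr_realpow)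
          finally show ?thesis using phi(2)[OF x] True by (simp add: nat_diff_distrib)
        next
          case False
          then have "x = (1 / 2) ^ (j - k)"
            by (simp add: x_def N_def d_def power_divide power_diff)
          then have "x powr b = \<rho> ^ (j - k)" by (simp add: \<rho>_def powr_power powr_powr mult.commute flip: powr_realpow)
          then show ?thesis using phi(1)[OF x] False by (simp add: nat_diff_distrib)
        qed
        then have "c j * (V * d j)
            \<le> C * V * real N powr (- b) * (E * \<rho> ^ nat \<bar>int j - int k\<bar>)"
          unfolding eq using C V by (intro mult_left_mono mult_nonneg_nonneg) auto
        then show ?thesis by (simp add: mult_ac)
      qed
      have "(\<Sum>j<n. ennreal (c j * (V * d j))) = ennreal (\<Sum>j<n. c j * (V * d j))"
        using c V d by (intro sum_ennreal) (simp add: less_imp_le)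
      also have "(\<Sum>j<n. c j * (V * d j))
          \<le> (\<Sum>j<n. C * V * E * real N powr (- b) * \<rho> ^ nat \<bar>int j - int k\<bar>)"
        by (intro sum_mono cj)
      also have "\<dots> = C * V * E * real N powr (- b) * (\<Sum>j<n. \<rho> ^ nat \<bar>int j - int k\<bar>)"
        by (simp add: sum_distrib_left)
      also have "\<dots> \<le> C * V * E * real N powr (- b) * (1 + 2 * (\<rho> / (1 - \<rho>)))"
        using C V E \<rho> by (intro mult_left_mono sum_geometric_dist_le) auto
      also have "\<dots> = K * real N powr (- b)" by (simp add: K_def mult_ac)
      finally show "(\<Sum>j<n. ennreal (c j * (V * d j))) \<le> ennreal (K * real N powr (- b))"
        by (simp add: ennreal_leI)
    qed (rule summableI)
    finally show ?thesis by (simp add: N_def)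
  qed
  with K show ?thesis by blast
qed

section \<open>The lacunary series\<close>

text \<open>Doubly exponential growth makes the logarithms of the degrees, hence the weights,
  geometric, and makes each degree at least the square of every earlier one. Powers of two are even
  and match the dyadic shells.\<close>

definition lac_degree :: "nat \<Rightarrow> nat" where
  "lac_degree i = 2 ^ (2 ^ i)"

definition lac_weight :: "real \<Rightarrow> nat \<Rightarrow> real" where
  "lac_weight \<gamma> i = ln (real (lac_degree i)) powr (- \<gamma>)"

text \<open>At distance 1/N from the sphere, with \<open>N\<close> the degree, this is the
  reciprocal of the normalising factor in the theorem when
  \<open>\<beta> = (1 - \<alpha>) / 2\<close> and
  \<open>\<gamma> = (1 + \<epsilon>) / 2\<close>.\<close>

definition lac_coeff :: "real \<Rightarrow> real \<Rightarrow> nat \<Rightarrow> real" where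
  "lac_coeff \<beta> \<gamma> i = lac_weight \<gamma> i * real (lac_degree i) powr \<beta>"

lemma lac_degree_pos: "0 < lac_degree i"
  by (simp add: lac_degree_def)

lemma even_lac_degree: "even (lac_degree i)"
  by (simp add: lac_degree_def)

lemma ln_lac_degree: "ln (real (lac_degree i)) = 2 ^ i * ln 2"
  by (simp add: lac_degree_def ln_realpow)

lemma lac_degree_eq_exp: "real (lac_degree i) = exp (2 ^ i * ln 2)"
  by (simp add: lac_degree_pos flip: ln_lac_degree)

lemma lac_degree_ge: "2 ^ i \<le> real (lac_degree i)"
proof -
  have "(i::nat) \<le> 2 ^ i" using less_exp[of i] by simp
  then show ?thesis by (simp add: lac_degree_def)
qed

lemma lac_degree_sq_le: "l < i \<Longrightarrow> (real (lac_degree l))\<^sup>2 \<le> real (lac_degree i)"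
proof -
  assume "l < i"
  then have "(2::nat) ^ Suc l \<le> 2 ^ i" by (intro power_increasing) auto
  then have "(2::real) ^ (2 ^ l * 2) \<le> 2 ^ (2 ^ i)" by (intro power_increasing) (auto simp: mult.commute)
  then show ?thesis by (simp add: lac_degree_def flip: power_mult)
qed

lemma lac_weight_nonneg: "0 \<le> lac_weight \<gamma> i"
  by (simp add: lac_weight_def)

lemma lac_coeff_pos: "0 < lac_coeff \<beta> \<gamma> i"
  using lac_degree_pos[of i] by (simp add: lac_coeff_def lac_weight_def ln_lac_degree)

lemma lac_weight_eq: "lac_weight \<gamma> i = ln 2 powr (- \<gamma>) * (2 powr (- \<gamma>)) ^ i"
  by (simp add: lac_weight_def ln_lac_degree powr_mult powr_powr mult.commute flip: powr_realpow)

lemma summable_lac_weight: "0 < \<gamma> \<Longrightarrow> summable (lac_weight \<gamma>)"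
  unfolding lac_weight_eq[abs_def]
  by (intro summable_mult summable_geometric) (simp add: powr_def)

lemma lac_weight_le:
  assumes "0 < \<gamma>"
  shows "lac_weight \<gamma> i \<le> ln 2 powr (- \<gamma>)"
  unfolding lac_weight_eq using assms
  by (intro mult_left_le power_le_one) (auto simp: powr_def)

text \<open>The exponential also controls one further power of the degree \<open>x\<close>, and the
  compensating factor \<open>1 / x\<close> is at most \<open>(1 / 2) ^ l\<close>.\<close>

lemma lac_coeff_exp_le:
  assumes "0 < \<beta>" "0 < \<gamma>" "0 < c"
  shows "lac_coeff \<beta> \<gamma> l * exp (- (c * real (lac_degree l)))
    \<le> ln 2 powr (- \<gamma>) * ((\<beta> + 1) / c) powr (\<beta> + 1) * (1 / 2) ^ l"
proof -
  define x where "x = real (lac_degree l)"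
  have x: "0 < x" "2 ^ l \<le> x" using lac_degree_pos lac_degree_ge by (auto simp: x_def)
  have "x powr \<beta> * exp (- (c * x)) = x powr (\<beta> + 1) * exp (- (c * x)) * (1 / x)"
    using x by (simp add: powr_add)
  also have "\<dots> \<le> ((\<beta> + 1) / c) powr (\<beta> + 1) * (1 / 2) ^ l"
    using assms x by (intro mult_mono powr_mult_exp_le) (auto simp: power_divide divide_simps)
  finally have le: "x powr \<beta> * exp (- (c * x)) \<le> ((\<beta> + 1) / c) powr (\<beta> + 1) * (1 / 2) ^ l" by simp
  have "lac_weight \<gamma> l * (x powr \<beta> * exp (- (c * x)))
      \<le> ln 2 powr (- \<gamma>) * (((\<beta> + 1) / c) powr (\<beta> + 1) * (1 / 2) ^ l)"
    using assms by (intro mult_mono[OF lac_weight_le le]) auto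
  then show ?thesis by (simp add: lac_coeff_def x_def mult.assoc)
qed

text \<open>With \<open>y\<close> the square root of the later degree \<open>x\<close>, the quotient
  of the degrees is at least \<open>y\<close>, so the exponential is at most
  \<open>exp (- y)\<close>. This beats every power of \<open>y\<close>, again with a factor
  \<open>1 / x\<close> to spare, uniformly in \<open>i\<close>.\<close>

lemma lac_coeff_tail_le:
  assumes "0 < \<beta>" "0 < \<gamma>" "i < l"
  shows "lac_coeff \<beta> \<gamma> l * exp (- (real (lac_degree l) / real (lac_degree i)))
    \<le> ln 2 powr (- \<gamma>) * (2 * \<beta> + 2) powr (2 * \<beta> + 2) * (1 / 2) ^ l"
proof -
  define x where "x = real (lac_degree l)"
  define y where "y = sqrt x"
  have x: "0 < x" "2 ^ l \<le> x" using lac_degree_pos lac_degree_ge by (auto simp: x_def)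
  have y: "0 < y" "x = y\<^sup>2" using x by (auto simp: y_def)
  have "real (lac_degree i) \<le> y"
    unfolding y_def x_def using lac_degree_sq_le[OF assms(3)] by (rule real_le_rsqrt)
  then have "y \<le> x / real (lac_degree i)"
    using lac_degree_pos[of i] y by (simp add: field_simps power2_eq_square)
  then have "x powr \<beta> * exp (- (x / real (lac_degree i))) \<le> x powr \<beta> * exp (- (1 * y))"
    by (intro mult_left_mono) auto
  also have "\<dots> = y powr (2 * \<beta> + 2) * exp (- (1 * y)) * (1 / x)"
    using y by (simp add: powr_add powr_powr powr_power field_simps flip: powr_numeral)
  also have "\<dots> \<le> ((2 * \<beta> + 2) / 1) powr (2 * \<beta> + 2) * (1 / 2) ^ l"
    using assms x y by (intro mult_mono powr_mult_exp_le) (auto simp: power_divide divide_simps)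
  finally have le: "x powr \<beta> * exp (- (x / real (lac_degree i)))
      \<le> (2 * \<beta> + 2) powr (2 * \<beta> + 2) * (1 / 2) ^ l" by simp
  have "lac_weight \<gamma> l * (x powr \<beta> * exp (- (x / real (lac_degree i))))
      \<le> ln 2 powr (- \<gamma>) * ((2 * \<beta> + 2) powr (2 * \<beta> + 2) * (1 / 2) ^ l)"
    using assms by (intro mult_mono[OF lac_weight_le le]) auto
  then show ?thesis by (simp add: lac_coeff_def x_def mult.assoc)
qed

text \<open>Each earlier degree is at most the square root of the \<open>i\<close>-th one,
  \<open>N\<close>. The earlier coefficients are therefore of order
  \<open>N powr (\<beta> / 2)\<close>, and there are at most logarithmically many of them, whereas
  the \<open>i\<close>-th coefficient is \<open>N powr \<beta>\<close> up to a logarithmic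
  factor.\<close>

lemma eventually_lac_coeff_dominates:
  assumes "0 < \<beta>" "0 < \<gamma>"
  shows "\<forall>\<^sub>F i in sequentially. (\<Sum>l<i. lac_coeff \<beta> \<gamma> l) + U \<le> lac_coeff \<beta> \<gamma> i / 32"
proof -
  define c0 where "c0 = ln (2::real) powr (- \<gamma>)"
  have c0: "0 < c0" by (simp add: c0_def)
  \<comment> \<open>The variable \<open>x\<close> stands for \<open>2 ^ i\<close>, so that
    \<open>N = exp (x * ln 2)\<close>. The number \<open>i\<close> of terms is replaced by the
    larger \<open>x\<close>, which leaves a limit in one real variable.\<close>
  define B where "B = (\<lambda>x::real. x * (c0 * exp (x * ln 2 * \<beta> / 2)) + U)"
  have "((\<lambda>x::real. (x * (c0 * exp (x * ln 2 * \<beta> / 2)) + U) / ((x * ln 2) powr (- \<gamma>) * exp (x * ln 2 * \<beta>))) \<longlongrightarrow> 0) at_top"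
    using assms c0 by real_asymp
  then have "\<forall>\<^sub>F x in at_top. B x / ((x * ln 2) powr (- \<gamma>) * exp (x * ln 2 * \<beta>)) < 1 / 32"
    unfolding B_def by (rule order_tendstoD) simp
  then have "\<forall>\<^sub>F i in sequentially.
      B (2 ^ i) / ((2 ^ i * ln 2) powr (- \<gamma>) * exp (2 ^ i * ln 2 * \<beta>)) < 1 / 32"
    by (rule eventually_compose_filterlim) real_asymp
  then show ?thesis
  proof eventually_elim
    case (elim i)
    have A: "lac_coeff \<beta> \<gamma> i = (2 ^ i * ln 2) powr (- \<gamma>) * exp (2 ^ i * ln 2 * \<beta>)"
      by (simp add: lac_coeff_def lac_weight_def ln_lac_degree lac_degree_eq_exp powr_def mult.commute)
    have "B (2 ^ i) \<le> lac_coeff \<beta> \<gamma> i / 32"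
      using elim lac_coeff_pos[of \<beta> \<gamma> i] unfolding A[symmetric] by (simp add: field_simps)
    moreover have "lac_coeff \<beta> \<gamma> l \<le> c0 * exp (2 ^ i * ln 2 * \<beta> / 2)" if "l < i" for l
    proof -
      have "real (lac_degree l) powr \<beta> \<le> exp (2 ^ i * ln 2 * \<beta> / 2)"
      proof -
        have "real (lac_degree l) powr \<beta> = ((real (lac_degree l))\<^sup>2) powr (\<beta> / 2)"
          using lac_degree_pos[of l] by (simp add: powr_powr flip: powr_numeral)
        also have "\<dots> \<le> real (lac_degree i) powr (\<beta> / 2)"
          using lac_degree_sq_le[OF that] assms by (intro powr_mono2) auto
        also have "\<dots> = exp (2 ^ i * ln 2 * \<beta> / 2)"
          by (simp add: lac_degree_eq_exp powr_def mult_ac)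
        finally show ?thesis .
      qed
      then show ?thesis
        unfolding lac_coeff_def c0_def using assms
        by (intro mult_mono lac_weight_le) auto
    qed
    then have "(\<Sum>l<i. lac_coeff \<beta> \<gamma> l) \<le> (\<Sum>l<i. c0 * exp (2 ^ i * ln 2 * \<beta> / 2))"
      by (intro sum_mono) auto
    moreover have "real i * (c0 * exp (2 ^ i * ln 2 * \<beta> / 2)) \<le> 2 ^ i * (c0 * exp (2 ^ i * ln 2 * \<beta> / 2))"
      using less_exp[of i] c0 by (intro mult_right_mono) (auto simp: less_imp_le)
    ultimately show ?case unfolding B_def by simp
  qed
qed

section \<open>The series, its membership in the Bergman space, and its size at the peaks\<close>

definition peak_series ::
    "real \<Rightarrow> real \<Rightarrow> nat \<Rightarrow> (nat \<Rightarrow> 'n::finite) \<Rightarrow> complex ^ 'n \<Rightarrow> complex" where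
  "peak_series \<beta> \<gamma> L \<sigma> z =
     (\<Sum>i. of_real (lac_coeff \<beta> \<gamma> i) * peak_poly L (lac_degree i) (\<sigma> i) z)"

lemma holomorphic_peak_poly: "holomorphic_several_on (peak_poly L N i) S"
proof -
  have "holomorphic_several_on (\<lambda>z. \<Sum>k\<in>peak_grid L N i. \<Prod>j\<in>UNIV.
      (z $ j * (1 / of_real (peak_radius L N i k j))) ^ peak_exponent L N i k j) S"
    by (intro holomorphic_several_on_sum holomorphic_several_on_prod holomorphic_several_on_power
        holomorphic_several_on_mult holomorphic_several_on_coord holomorphic_several_on_const)
  then show ?thesis
    by (simp add: peak_poly_def[abs_def] peak_monomial_def)
qed

lemma norm_peak_term_le:
  fixes z :: "complex ^ 'n::finite"
  assumes "sparse_spacing TYPE('n) L"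
  shows "cmod (of_real (lac_coeff \<beta> \<gamma> l) * peak_poly L (lac_degree l) i z)
    \<le> 3 / 2 * lac_coeff \<beta> \<gamma> l * norm z ^ lac_degree l"
proof -
  have "cmod (of_real (lac_coeff \<beta> \<gamma> l) * peak_poly L (lac_degree l) i z)
      = lac_coeff \<beta> \<gamma> l * cmod (peak_poly L (lac_degree l) i z)"
    using lac_coeff_pos[of \<beta> \<gamma> l] by (simp add: norm_mult)
  also have "\<dots> \<le> lac_coeff \<beta> \<gamma> l * (3 / 2 * norm z ^ lac_degree l)"
    using norm_peak_poly_le[OF assms lac_degree_pos] lac_coeff_pos[of \<beta> \<gamma> l]
    by (intro mult_left_mono) (auto simp: less_imp_le)
  finally show ?thesis by (simp add: mult_ac)
qed

lemma summable_lac_coeff_power: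
  assumes "0 < \<beta>" "0 < \<gamma>" "0 \<le> r" "r < 1"
  shows "summable (\<lambda>l. 3 / 2 * lac_coeff \<beta> \<gamma> l * r ^ lac_degree l)"
proof -
  let ?K = "ln 2 powr (- \<gamma>) * ((\<beta> + 1) / (1 - r)) powr (\<beta> + 1)"
  have "summable (\<lambda>l. 3 / 2 * (?K * (1 / 2 :: real) ^ l))"
    by (intro summable_mult summable_geometric) auto
  then show ?thesis
  proof (rule summable_comparison_test')
    fix l
    have "lac_coeff \<beta> \<gamma> l * r ^ lac_degree l
        \<le> lac_coeff \<beta> \<gamma> l * exp (- ((1 - r) * real (lac_degree l)))"
      using power_le_exp[OF assms(3), of "lac_degree l"] lac_coeff_pos[of \<beta> \<gamma> l]
      by (intro mult_left_mono) (auto simp: mult.commute less_imp_le)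
    also have "\<dots> \<le> ?K * (1 / 2) ^ l"
      using assms by (intro lac_coeff_exp_le) auto
    finally show "norm (3 / 2 * lac_coeff \<beta> \<gamma> l * r ^ lac_degree l) \<le> 3 / 2 * (?K * (1 / 2) ^ l)"
      using assms lac_coeff_pos[of \<beta> \<gamma> l] by (simp add: abs_mult less_imp_le mult_ac)
  qed
qed

lemma summable_norm_peak_series:
  fixes z :: "complex ^ 'n::finite"
  assumes "sparse_spacing TYPE('n) L" "0 < \<beta>" "0 < \<gamma>" "norm z < 1"
  shows "summable (\<lambda>l. cmod (of_real (lac_coeff \<beta> \<gamma> l) * peak_poly L (lac_degree l) (\<sigma> l) z))"
  using norm_peak_term_le[OF assms(1)] assms
  by (intro summable_comparison_test'[OF summable_lac_coeff_power[of \<beta> \<gamma> "norm z"]]) auto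

lemma norm_peak_series_le:
  fixes z :: "complex ^ 'n::finite"
  assumes "sparse_spacing TYPE('n) L" "0 < \<beta>" "0 < \<gamma>" "norm z < 1"
  shows "cmod (peak_series \<beta> \<gamma> L \<sigma> z)
    \<le> (\<Sum>l. 3 / 2 * lac_coeff \<beta> \<gamma> l * norm z ^ lac_degree l)"
  unfolding peak_series_def using assms
  by (intro norm_suminf_le norm_peak_term_le summable_lac_coeff_power) auto

lemma holomorphic_peak_series:
  assumes L: "sparse_spacing TYPE('n::finite) L" and pos: "0 < \<beta>" "0 < \<gamma>"
  shows "holomorphic_several_on (peak_series \<beta> \<gamma> L (\<sigma> :: nat \<Rightarrow> 'n)) (ball 0 1)"
  unfolding peak_series_def[abs_def]
proof (rule holomorphic_several_on_suminf)
  fix r :: real assume r: "0 < r" "r < 1"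
  let ?M = "\<lambda>l. 3 / 2 * lac_coeff \<beta> \<gamma> l * r ^ lac_degree l"
  have "cmod (of_real (lac_coeff \<beta> \<gamma> l) * peak_poly L (lac_degree l) (\<sigma> l) z) \<le> ?M l"
    if "z \<in> cball 0 r" for l z
  proof -
    have "3 / 2 * lac_coeff \<beta> \<gamma> l * norm z ^ lac_degree l \<le> ?M l"
      using that lac_coeff_pos[of \<beta> \<gamma> l] by (intro mult_left_mono power_mono) (auto simp: less_imp_le)
    then show ?thesis using norm_peak_term_le[OF L] order_trans by blast
  qed
  moreover have "summable ?M" using pos r by (intro summable_lac_coeff_power) auto
  ultimately show "\<exists>M. summable M \<and> (\<forall>l. \<forall>z\<in>cball 0 r.
      cmod (of_real (lac_coeff \<beta> \<gamma> l) * peak_poly L (lac_degree l) (\<sigma> l) z) \<le> M l)"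
    by blast
qed (intro holomorphic_several_on_mult holomorphic_several_on_const holomorphic_peak_poly)

text \<open>With \<delta> the distance to the sphere, a term of degree \<open>N\<close> is
  controlled by its weight times
  \<open>(N * \<delta>) powr \<beta> * exp (- (N * \<delta>))\<close>. The latter is bounded
  independently of \<open>N\<close>, and the weights are summable.\<close>

lemma norm_peak_series_weighted_le:
  fixes z :: "complex ^ 'n::finite"
  assumes "sparse_spacing TYPE('n) L" "0 < \<beta>" "0 < \<gamma>" "norm z < 1"
  shows "cmod (peak_series \<beta> \<gamma> L \<sigma> z) * (1 - norm z) powr \<beta>
    \<le> 3 / 2 * \<beta> powr \<beta> * (\<Sum>l. lac_weight \<gamma> l)"
proof -
  define \<delta> where "\<delta> = 1 - norm z"
  have \<delta>: "0 < \<delta>" using assms by (simp add: \<delta>_def)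
  let ?t = "\<lambda>l. 3 / 2 * lac_coeff \<beta> \<gamma> l * norm z ^ lac_degree l"
  have sm: "summable ?t" using assms by (intro summable_lac_coeff_power) auto
  have "cmod (peak_series \<beta> \<gamma> L \<sigma> z) * \<delta> powr \<beta> \<le> (\<Sum>l. ?t l) * \<delta> powr \<beta>"
    using assms by (intro mult_right_mono norm_peak_series_le) auto
  also have "\<dots> = (\<Sum>l. ?t l * \<delta> powr \<beta>)" by (rule suminf_mult2[OF sm])
  also have "\<dots> \<le> (\<Sum>l. 3 / 2 * \<beta> powr \<beta> * lac_weight \<gamma> l)"
  proof (rule suminf_le)
    fix l
    let ?N = "real (lac_degree l)"
    have "norm z ^ lac_degree l * (?N powr \<beta> * \<delta> powr \<beta>) \<le> exp (- (?N * \<delta>)) * (?N powr \<beta> * \<delta> powr \<beta>)"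
      unfolding \<delta>_def by (intro mult_right_mono power_le_exp) auto
    also have "\<dots> = (?N * \<delta>) powr \<beta> * exp (- (1 * (?N * \<delta>)))"
      using \<delta> by (simp add: powr_mult)
    also have "\<dots> \<le> (\<beta> / 1) powr \<beta>"
      using assms \<delta> by (intro powr_mult_exp_le) auto
    finally have le: "norm z ^ lac_degree l * (?N powr \<beta> * \<delta> powr \<beta>) \<le> \<beta> powr \<beta>" by simp
    have "?t l * \<delta> powr \<beta> = 3 / 2 * lac_weight \<gamma> l * (norm z ^ lac_degree l * (?N powr \<beta> * \<delta> powr \<beta>))"
      by (simp add: lac_coeff_def)
    also have "\<dots> \<le> 3 / 2 * lac_weight \<gamma> l * \<beta> powr \<beta>"
      by (intro mult_left_mono le) (simp add: lac_weight_nonneg)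
    finally show "?t l * \<delta> powr \<beta> \<le> 3 / 2 * \<beta> powr \<beta> * lac_weight \<gamma> l" by (simp add: mult_ac)
  qed (intro summable_mult2[OF sm] summable_mult summable_lac_weight assms)+
  also have "\<dots> = 3 / 2 * \<beta> powr \<beta> * (\<Sum>l. lac_weight \<gamma> l)"
    by (rule suminf_mult[OF summable_lac_weight[OF assms(3)]])
  finally show ?thesis by (simp add: \<delta>_def)
qed

text \<open>Since \<open>\<bar>f\<bar> \<delta>\<^sup>\<beta>\<close> is bounded, the square integral reduces to the integral of
  \<open>\<bar>f\<bar> \<delta>\<^sup>\<beta>\<^sup>-\<^sup>1\<close>, which can be estimated termwise.\<close>
lemma peak_series_in_weighted_bergman_space:
  fixes \<sigma> :: "nat \<Rightarrow> 'n::finite"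
  assumes L: "sparse_spacing TYPE('n) L" and \<alpha>: "\<alpha> < 1" and \<gamma>: "0 < \<gamma>"
  defines "\<beta> \<equiv> (1 - \<alpha>) / 2"
  shows "peak_series \<beta> \<gamma> L \<sigma> \<in> weighted_bergman_space \<alpha>"
proof -
  have \<beta>: "0 < \<beta>" and \<alpha>\<beta>: "- \<alpha> = \<beta> + (\<beta> - 1)" using \<alpha> by (auto simp: \<beta>_def field_simps)
  let ?f = "peak_series \<beta> \<gamma> L \<sigma>"
  define C where "C = 3 / 2 * \<beta> powr \<beta> * (\<Sum>l. lac_weight \<gamma> l)"
  have C: "0 \<le> C"
    unfolding C_def using suminf_nonneg[OF summable_lac_weight[OF \<gamma>]] lac_weight_nonneg by simp
  obtain K where K: "0 \<le> K" and int: "\<And>k. (\<integral>\<^sup>+ z \<in> ball (0::complex^'n) 1.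
      ennreal (norm z ^ (2 ^ k) * (1 - norm z) powr (\<beta> - 1)) \<partial>lborel)
    \<le> ennreal (K * (2 ^ k) powr (- \<beta>))"
    using nn_integral_norm_power_weight_le[OF \<beta>, where 'a = "complex^'n"] by blast
  define g where "g = (\<lambda>l (z::complex^'n). norm z ^ lac_degree l * (1 - norm z) powr (\<beta> - 1))"
  have intg: "(\<integral>\<^sup>+ z. ennreal (g l z) * indicator (ball 0 1) z \<partial>lborel)
      \<le> ennreal (K * real (lac_degree l) powr (- \<beta>))" for l
    using int[of "2 ^ l"] by (simp add: g_def lac_degree_def)
  define a where "a = (\<lambda>l. C * (3 / 2 * lac_coeff \<beta> \<gamma> l))"
  have a: "0 \<le> a l" for l using C lac_coeff_pos[of \<beta> \<gamma> l] by (simp add: a_def)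
  have pt: "ennreal ((cmod (?f z))\<^sup>2 * (1 - norm z) powr (- \<alpha>)) * indicator (ball 0 1) z
      \<le> (\<Sum>l. ennreal (a l) * (ennreal (g l z) * indicator (ball 0 1) z))" for z
  proof (cases "norm z < 1")
    case True
    define \<delta> where "\<delta> = 1 - norm z"
    have \<delta>: "0 < \<delta>" using True by (simp add: \<delta>_def)
    let ?t = "\<lambda>l. 3 / 2 * lac_coeff \<beta> \<gamma> l * norm z ^ lac_degree l"
    have sm: "summable ?t" using True \<beta> \<gamma> by (intro summable_lac_coeff_power) auto
    have ag: "a l * g l z = C * \<delta> powr (\<beta> - 1) * ?t l" for l
      by (simp add: a_def g_def \<delta>_def)
    have smag: "summable (\<lambda>l. a l * g l z)" unfolding ag by (rule summable_mult[OF sm])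
    have "(cmod (?f z))\<^sup>2 * \<delta> powr (- \<alpha>) = (cmod (?f z) * \<delta> powr \<beta>) * (cmod (?f z) * \<delta> powr (\<beta> - 1))"
      unfolding \<alpha>\<beta> powr_add by (simp add: power2_eq_square)
    also have "\<dots> \<le> C * ((\<Sum>l. ?t l) * \<delta> powr (\<beta> - 1))"
    proof (rule mult_mono)
      show "cmod (?f z) * \<delta> powr \<beta> \<le> C"
        unfolding C_def \<delta>_def by (rule norm_peak_series_weighted_le[OF L \<beta> \<gamma> True])
      show "cmod (?f z) * \<delta> powr (\<beta> - 1) \<le> (\<Sum>l. ?t l) * \<delta> powr (\<beta> - 1)"
        by (intro mult_right_mono norm_peak_series_le[OF L \<beta> \<gamma> True]) simp
    qed (use C in auto)
    also have "\<dots> = (\<Sum>l. a l * g l z)"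
      unfolding ag using suminf_mult[OF sm, of "C * \<delta> powr (\<beta> - 1)"] by (simp add: mult_ac)
    finally have "ennreal ((cmod (?f z))\<^sup>2 * \<delta> powr (- \<alpha>)) \<le> ennreal (\<Sum>l. a l * g l z)"
      by (rule ennreal_leI)
    also have "\<dots> = (\<Sum>l. ennreal (a l * g l z))"
      using a smag by (intro suminf_ennreal2[symmetric]) (auto simp: g_def)
    also have "\<dots> = (\<Sum>l. ennreal (a l) * (ennreal (g l z) * indicator (ball 0 1) z))"
      using True a by (simp add: ennreal_mult' g_def)
    finally show ?thesis using True by (simp add: \<delta>_def)
  qed simp
  have gmeas: "(\<lambda>z. ennreal (g l z) * indicator (ball 0 1) z) \<in> borel_measurable lborel" for l
  proof -
    have [measurable]: "ball (0::complex^'n) 1 \<in> sets borel" by simp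
    show ?thesis unfolding g_def by measurable
  qed
  have "(\<integral>\<^sup>+ z \<in> ball 0 1. ennreal ((cmod (?f z))\<^sup>2 * (1 - norm z) powr (- \<alpha>)) \<partial>lborel)
      \<le> (\<integral>\<^sup>+ z. (\<Sum>l. ennreal (a l) * (ennreal (g l z) * indicator (ball 0 1) z)) \<partial>lborel)"
    by (intro nn_integral_mono pt)
  also have "\<dots> = (\<Sum>l. ennreal (a l) * (\<integral>\<^sup>+ z. ennreal (g l z) * indicator (ball 0 1) z \<partial>lborel))"
    using gmeas by (subst nn_integral_suminf) (auto simp: nn_integral_cmult)
  also have "\<dots> \<le> (\<Sum>l. ennreal (C * (3 / 2) * K * lac_weight \<gamma> l))"
  proof (intro suminf_le summableI)
    fix l
    have "ennreal (a l) * (\<integral>\<^sup>+ z. ennreal (g l z) * indicator (ball 0 1) z \<partial>lborel)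
        \<le> ennreal (a l) * ennreal (K * real (lac_degree l) powr (- \<beta>))"
      by (intro mult_left_mono intg) simp
    also have "\<dots> = ennreal (a l * (K * real (lac_degree l) powr (- \<beta>)))"
      using a by (simp add: ennreal_mult')
    \<comment> \<open>The integral decays with exactly the power of the degree that the coefficient
      contains, so only the summable weight survives.\<close>
    also have "a l * (K * real (lac_degree l) powr (- \<beta>)) = C * (3 / 2) * K * lac_weight \<gamma> l"
      using lac_degree_pos[of l] by (simp add: a_def lac_coeff_def powr_minus)
    finally show "ennreal (a l) * (\<integral>\<^sup>+ z. ennreal (g l z) * indicator (ball 0 1) z \<partial>lborel)
        \<le> ennreal (C * (3 / 2) * K * lac_weight \<gamma> l)" .
  qed
  also have "\<dots> = ennreal (\<Sum>l. C * (3 / 2) * K * lac_weight \<gamma> l)"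
    using C K by (intro suminf_ennreal2 summable_mult summable_lac_weight \<gamma>)
      (auto simp: lac_weight_nonneg)
  also have "\<dots> < \<infinity>" by simp
  finally show ?thesis
    unfolding weighted_bergman_space_def using holomorphic_peak_series[OF L \<beta> \<gamma>] by simp
qed

text \<open>At depth 1/N, with \<open>N\<close> the \<open>i\<close>-th degree, the
  \<open>i\<close>-th term has modulus at least 1/8 of its coefficient. Earlier terms are small
  because their coefficients are, later ones because their powers of \<open>norm z\<close>
  are.\<close>

lemma eventually_norm_peak_series_ge:
  fixes \<sigma> :: "nat \<Rightarrow> 'n::finite"
  assumes L: "sparse_spacing TYPE('n) L" and \<beta>: "0 < \<beta>" and \<gamma>: "0 < \<gamma>"
  shows "\<forall>\<^sub>F i in sequentially. \<forall>z. norm z = 1 - 1 / real (lac_degree i) \<longrightarrow>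
    1 / 8 \<le> cmod (peak_poly L (lac_degree i) (\<sigma> i) z) \<longrightarrow>
    lac_coeff \<beta> \<gamma> i / 16 \<le> cmod (peak_series \<beta> \<gamma> L \<sigma> z)"
proof -
  define U where "U = ln 2 powr (- \<gamma>) * (2 * \<beta> + 2) powr (2 * \<beta> + 2)"
  have U: "0 \<le> U" by (simp add: U_def)
  \<comment> \<open>The earlier terms cost 3/2 of the sum of their coefficients and the later ones
    \<open>3 * U\<close>. With \<open>2 * U\<close> in place of \<open>U\<close> both together are
    at most 3/64 of the \<open>i\<close>-th coefficient, which leaves more than 1/16 of it.\<close>
  show ?thesis using eventually_lac_coeff_dominates[OF \<beta> \<gamma>, of "2 * U"]
  proof eventually_elim
    case (elim i)
    show ?case
    proof (intro allI impI)
      fix z :: "complex ^ 'n"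
      assume nz: "norm z = 1 - 1 / real (lac_degree i)"
        and peak: "1 / 8 \<le> cmod (peak_poly L (lac_degree i) (\<sigma> i) z)"
      define h where "h = (\<lambda>l. of_real (lac_coeff \<beta> \<gamma> l) * peak_poly L (lac_degree l) (\<sigma> l) z)"
      have z1: "norm z < 1" using nz lac_degree_pos[of i] by simp
      have sn: "summable (\<lambda>l. cmod (h l))"
        unfolding h_def using L \<beta> \<gamma> z1 by (rule summable_norm_peak_series)
      have hb: "cmod (h l) \<le> 3 / 2 * lac_coeff \<beta> \<gamma> l * norm z ^ lac_degree l" for l
        unfolding h_def by (rule norm_peak_term_le[OF L])
      have low: "cmod (\<Sum>l<i. h l) \<le> 3 / 2 * (\<Sum>l<i. lac_coeff \<beta> \<gamma> l)"
      proof -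
        have "cmod (\<Sum>l<i. h l) \<le> (\<Sum>l<i. 3 / 2 * lac_coeff \<beta> \<gamma> l)"
        proof (rule sum_norm_le)
          fix l
          have "3 / 2 * lac_coeff \<beta> \<gamma> l * norm z ^ lac_degree l \<le> 3 / 2 * lac_coeff \<beta> \<gamma> l * 1"
            using z1 lac_coeff_pos[of \<beta> \<gamma> l] by (intro mult_left_mono power_le_one) auto
          then show "cmod (h l) \<le> 3 / 2 * lac_coeff \<beta> \<gamma> l" using hb[of l] by simp
        qed
        then show ?thesis by (simp add: sum_distrib_left)
      qed
      have tl: "cmod (h (l + Suc i)) \<le> 3 / 2 * U * (1 / 2) ^ l" for l
      proof -
        define m where "m = l + Suc i"
        have "norm z ^ lac_degree m \<le> exp (- (real (lac_degree m) / real (lac_degree i)))"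
          using power_le_exp[OF norm_ge_zero, of z "lac_degree m"] unfolding nz by simp
        then have "lac_coeff \<beta> \<gamma> m * norm z ^ lac_degree m
            \<le> lac_coeff \<beta> \<gamma> m * exp (- (real (lac_degree m) / real (lac_degree i)))"
          using lac_coeff_pos[of \<beta> \<gamma> m] by (intro mult_left_mono) auto
        also have "\<dots> \<le> U * (1 / 2) ^ m"
          unfolding U_def using \<beta> \<gamma> by (rule lac_coeff_tail_le) (simp add: m_def)
        also have "\<dots> \<le> U * (1 / 2) ^ l"
          using U by (intro mult_left_mono power_decreasing) (auto simp: m_def)
        finally show ?thesis using hb[of m] by (simp add: m_def)
      qed
      have tail: "cmod (\<Sum>l. h (l + Suc i)) \<le> 3 * U"
      proof -
        have "(\<lambda>l. 3 / 2 * U * (1 / 2) ^ l) sums (3 / 2 * U * (1 / (1 - 1 / 2)))"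
          by (intro sums_mult geometric_sums) auto
        then have s: "summable (\<lambda>l. 3 / 2 * U * (1 / 2) ^ l)"
          "(\<Sum>l. 3 / 2 * U * (1 / 2) ^ l) = 3 * U" by (auto simp: sums_iff)
        show ?thesis using norm_suminf_le[OF tl s(1)] s(2) by simp
      qed
      have "peak_series \<beta> \<gamma> L \<sigma> z = (\<Sum>l. h (l + Suc i)) + (\<Sum>l<Suc i. h l)"
        unfolding peak_series_def h_def[symmetric]
        by (rule suminf_split_initial_segment[OF summable_norm_cancel[OF sn]])
      then have "peak_series \<beta> \<gamma> L \<sigma> z = h i + ((\<Sum>l<i. h l) + (\<Sum>l. h (l + Suc i)))"
        by simp
      then have "cmod (h i) - (cmod (\<Sum>l<i. h l) + cmod (\<Sum>l. h (l + Suc i)))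
          \<le> cmod (peak_series \<beta> \<gamma> L \<sigma> z)"
        using norm_diff_ineq[of "h i" "(\<Sum>l<i. h l) + (\<Sum>l. h (l + Suc i))"]
          norm_triangle_ineq[of "\<Sum>l<i. h l" "\<Sum>l. h (l + Suc i)"] by simp
      moreover have "lac_coeff \<beta> \<gamma> i / 8 \<le> cmod (h i)"
      proof -
        have "lac_coeff \<beta> \<gamma> i * (1 / 8) \<le> lac_coeff \<beta> \<gamma> i * cmod (peak_poly L (lac_degree i) (\<sigma> i) z)"
          using peak lac_coeff_pos[of \<beta> \<gamma> i] by (intro mult_left_mono) auto
        then show ?thesis using lac_coeff_pos[of \<beta> \<gamma> i] by (simp add: h_def norm_mult)
      qed
      ultimately show "lac_coeff \<beta> \<gamma> i / 16 \<le> cmod (peak_series \<beta> \<gamma> L \<sigma> z)"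
        using low tail elim lac_coeff_pos[of \<beta> \<gamma> i] by linarith
    qed
  qed
qed

text \<open>Expanding the square leaves at most twice the real part of one minus the Hermitian
  product. Hence points of the region close to the sphere are close to \<zeta>, and the peaks
  approach \<zeta> as the degree grows.\<close>

lemma koranyi_region_dist:
  assumes "z \<in> koranyi_region t \<zeta>" "norm \<zeta> = 1"
  shows "(dist z \<zeta>)\<^sup>2 \<le> 2 * t * (1 - norm z)"
proof -
  have z: "norm z < 1" "cmod (1 - hermitian_dot z \<zeta>) < t * (1 - norm z)"
    using assms by (auto simp: koranyi_region_def)
  have "(dist z \<zeta>)\<^sup>2 = (\<Sum>j\<in>UNIV. (cmod (z $ j - \<zeta> $ j))\<^sup>2)"
    by (simp add: dist_norm norm_vec_sq)
  also have "\<dots> = (\<Sum>j\<in>UNIV. (cmod (z $ j))\<^sup>2 + (cmod (\<zeta> $ j))\<^sup>2 - 2 * Re (z $ j * cnj (\<zeta> $ j)))"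
    by (rule sum.cong) (auto simp: cmod_power2 power2_diff algebra_simps)
  also have "\<dots> = (norm z)\<^sup>2 + (norm \<zeta>)\<^sup>2 - 2 * Re (hermitian_dot z \<zeta>)"
    by (simp add: norm_vec_sq sum.distrib sum_subtractf hermitian_dot_def sum_distrib_left)
  also have "\<dots> \<le> 2 * Re (1 - hermitian_dot z \<zeta>)"
    using z(1) assms(2) power_le_one[of "norm z" 2] by simp
  also have "\<dots> \<le> 2 * cmod (1 - hermitian_dot z \<zeta>)" 
    by (intro mult_left_mono complex_Re_le_cmod) simp
  finally show ?thesis using z(2) by linarith
qed

theorem theorem1p7:
  fixes \<alpha> :: real
  assumes "\<alpha> < 1"
  shows "\<exists>t>1. \<forall>\<epsilon>>0.
    \<exists>f \<in> (weighted_bergman_space \<alpha> :: (complex ^ 'n::finite \<Rightarrow> complex) set).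
      \<forall>\<zeta> \<in> sphere 0 1.
        Limsup (at \<zeta> within koranyi_region t \<zeta>)
          (\<lambda>z. ereal (cmod (f z) * (1 - norm z) powr ((1 - \<alpha>) / 2)
                        * \<bar>ln (1 - norm z)\<bar> powr ((1 + \<epsilon>) / 2))) > 0"
proof -
  obtain L where L: "sparse_spacing TYPE('n) L"
    using ex_lattice_spacing[of "CARD('n)"] unfolding sparse_spacing_def by blast
  define t where "t = 2 + real CARD('n) * (2 * real CARD('n) * real L)\<^sup>2 / 2"
  have t: "1 < t" 
  proof -
    have "0 \<le> real CARD('n) * (2 * real CARD('n) * real L)\<^sup>2 / 2"
      by (intro divide_nonneg_nonneg mult_nonneg_nonneg zero_le_power2) simp_all
    then show ?thesis unfolding t_def by linarith
  qed
  obtain b :: "nat \<Rightarrow> 'n" where b: "bij_betw b {0..<CARD('n)} UNIV"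
    using ex_bij_betw_nat_finite[of "UNIV :: 'n set"] by auto
  \<comment> \<open>The coordinate of largest modulus depends on \<zeta>, but the function must not;
    cycling lets every coordinate be the distinguished one for infinitely many degrees.\<close>
  define \<sigma> where "\<sigma> = (\<lambda>i. b (i mod CARD('n)))"
  have cycle: "\<exists>i\<ge>m. \<sigma> i = l" for m l
  proof -
    have "l \<in> b ` {0..<CARD('n)}" using b by (auto simp: bij_betw_def)
    then obtain k where k: "k < CARD('n)" "b k = l" by auto
    then have "\<sigma> (k + CARD('n) * m) = l" by (simp add: \<sigma>_def)
    moreover have "m \<le> k + CARD('n) * m" using k by (simp add: trans_le_add2)
    ultimately show ?thesis by blast
  qed
  define \<beta> where "\<beta> = (1 - \<alpha>) / 2"
  have \<beta>: "0 < \<beta>" using assms by (simp add: \<beta>_def)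
  have "\<exists>f \<in> weighted_bergman_space \<alpha>. \<forall>\<zeta> \<in> sphere (0 :: complex ^ 'n) 1.
        Limsup (at \<zeta> within koranyi_region t \<zeta>)
          (\<lambda>z. ereal (cmod (f z) * (1 - norm z) powr \<beta> * \<bar>ln (1 - norm z)\<bar> powr ((1 + \<epsilon>) / 2))) > 0"
    if \<epsilon>: "0 < \<epsilon>" for \<epsilon>
  proof (intro bexI ballI)
    define \<gamma> where "\<gamma> = (1 + \<epsilon>) / 2"
    have \<gamma>: "0 < \<gamma>" using \<epsilon> by (simp add: \<gamma>_def)
    let ?f = "peak_series \<beta> ((1 + \<epsilon>) / 2) L \<sigma>"
    show "?f \<in> weighted_bergman_space \<alpha>"
      unfolding \<beta>_def using peak_series_in_weighted_bergman_space[OF L assms \<gamma>] by (simp add: \<gamma>_def)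
    fix \<zeta> :: "complex ^ 'n" assume "\<zeta> \<in> sphere 0 1"
    then have \<zeta>: "norm \<zeta> = 1" by simp
    obtain l where max: "\<And>j. cmod (\<zeta> $ j) \<le> cmod (\<zeta> $ l)"
    proof -
      have "Max (range (\<lambda>j. cmod (\<zeta> $ j))) \<in> range (\<lambda>j. cmod (\<zeta> $ j))"
        by (intro Max_in) auto
      then obtain l where l: "Max (range (\<lambda>j. cmod (\<zeta> $ j))) = cmod (\<zeta> $ l)" by (rule imageE)
      have "cmod (\<zeta> $ j) \<le> Max (range (\<lambda>j. cmod (\<zeta> $ j)))" for j by (rule Max_ge) auto
      then show ?thesis unfolding l by (rule that)
    qed
    define G where "G = (\<lambda>z. cmod (?f z) * (1 - norm z) powr \<beta> * \<bar>ln (1 - norm z)\<bar> powr ((1 + \<epsilon>) / 2))"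
    have "ereal (1 / 16) \<le> Limsup (at \<zeta> within koranyi_region t \<zeta>) (\<lambda>z. ereal (G z))"
    proof (rule Limsup_greatest)
      fix P assume "eventually P (at \<zeta> within koranyi_region t \<zeta>)"
      then obtain d where d: "0 < d" "\<And>z. z \<in> koranyi_region t \<zeta> \<Longrightarrow> z \<noteq> \<zeta> \<Longrightarrow> dist z \<zeta> < d \<Longrightarrow> P z"
        unfolding eventually_at by blast
      have "filterlim (\<lambda>i. real (lac_degree i)) at_top sequentially"
        by (rule filterlim_at_top_mono[of "\<lambda>i. 2 ^ i"]) (real_asymp, intro always_eventually allI lac_degree_ge)
      \<comment> \<open>By \<open>koranyi_region_dist\<close> this threshold brings a point of depth
        1/N in the region within distance \<open>d\<close> of \<zeta>.\<close>
      then have "\<forall>\<^sub>F i in sequentially. 2 * t / d\<^sup>2 < real (lac_degree i)"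
        by (simp add: filterlim_at_top_dense)
      with eventually_norm_peak_series_ge[OF L \<beta> \<gamma>, of \<sigma>]
      have "\<forall>\<^sub>F i in sequentially. 2 * t / d\<^sup>2 < real (lac_degree i) \<and>
          (\<forall>z. norm z = 1 - 1 / real (lac_degree i) \<longrightarrow>
            1 / 8 \<le> cmod (peak_poly L (lac_degree i) (\<sigma> i) z) \<longrightarrow>
            lac_coeff \<beta> \<gamma> i / 16 \<le> cmod (peak_series \<beta> \<gamma> L \<sigma> z))"
        by eventually_elim blast
      then obtain m where m: "\<And>i. m \<le> i \<Longrightarrow> 2 * t / d\<^sup>2 < real (lac_degree i)"
        "\<And>i z. m \<le> i \<Longrightarrow> norm z = 1 - 1 / real (lac_degree i) \<Longrightarrow>
            1 / 8 \<le> cmod (peak_poly L (lac_degree i) (\<sigma> i) z) \<Longrightarrow>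
            lac_coeff \<beta> \<gamma> i / 16 \<le> cmod (peak_series \<beta> \<gamma> L \<sigma> z)"
        unfolding eventually_sequentially by blast
      obtain i where i: "m \<le> i" "\<sigma> i = l" using cycle by blast
      let ?N = "real (lac_degree i)"
      have N: "0 < ?N" using lac_degree_pos by simp
      obtain z where z: "z \<in> koranyi_region t \<zeta>" "norm z = 1 - 1 / ?N"
        "1 / 8 \<le> cmod (peak_poly L (lac_degree i) l z)"
        using ex_koranyi_peak[OF L even_lac_degree lac_degree_pos \<zeta> max] unfolding t_def by blast
      have "(dist z \<zeta>)\<^sup>2 \<le> 2 * t * (1 / ?N)" using koranyi_region_dist[OF z(1) \<zeta>] z(2) by simp
      also have "\<dots> < d\<^sup>2" using m(1)[OF i(1)] N d(1) by (simp add: field_simps)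
      finally have "dist z \<zeta> < d" using d(1) by (simp add: power_less_imp_less_base)
      moreover have "z \<noteq> \<zeta>" using z(2) \<zeta> N by auto
      ultimately have "P z" using d(2) z(1) by blast
      have "lac_coeff \<beta> \<gamma> i / 16 \<le> cmod (?f z)"
        using m(2)[OF i(1) z(2)] z(3) i(2) by (simp add: \<gamma>_def)
      then have "lac_coeff \<beta> \<gamma> i / 16 * ((1 / ?N) powr \<beta> * \<bar>ln (1 / ?N)\<bar> powr \<gamma>)
          \<le> cmod (?f z) * ((1 / ?N) powr \<beta> * \<bar>ln (1 / ?N)\<bar> powr \<gamma>)"
        by (intro mult_right_mono) auto
      \<comment> \<open>The normalising factor at depth 1/N cancels the coefficient exactly, so the
        lower bound 1/16 is the same for all \<zeta>.\<close>
      moreover have "lac_coeff \<beta> \<gamma> i * ((1 / ?N) powr \<beta> * \<bar>ln (1 / ?N)\<bar> powr \<gamma>) = 1"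
        using N by (simp add: lac_coeff_def lac_weight_def ln_div ln_lac_degree powr_minus powr_divide)
      ultimately have "1 / 16 \<le> G z"
        using z(2) by (simp add: G_def \<gamma>_def mult.assoc)
      then show "ereal (1 / 16) \<le> (SUP z\<in>Collect P. ereal (G z))"
        using \<open>P z\<close> by (intro SUP_upper2[of z]) auto
    qed
    then show "0 < Limsup (at \<zeta> within koranyi_region t \<zeta>)
        (\<lambda>z. ereal (cmod (?f z) * (1 - norm z) powr \<beta> * \<bar>ln (1 - norm z)\<bar> powr ((1 + \<epsilon>) / 2)))"
      unfolding G_def by (rule less_le_trans[rotated]) simp
  qed
  then show ?thesis using t unfolding \<beta>_def by blast
qed

end
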